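(* Let $U, W \subsetneq \mathbb{C}$ be simply connected domains containing $0$, and suppose that $d(U) < \frac{1}{\sqrt{2}}\, d(W)$. Then, for all sufficiently small $t>0$, $$\mathbf{P}(T^U<t) > \mathbf{P}(T^W<t).$$ In fact, $$\lim_{t\to 0^+} \frac{\mathbf{P}(T^U<t)}{\mathbf{P}(T^W<t)} = \infty.$$
   Context: $Z_t = X_t + iY_t$, $t\ge 0$, is standard planar Brownian motion with $Z_0=0$ almost surely, and $\mathbf{P}$ is the corresponding probability measure. For a domain $D\subseteq\mathbb{C}$ containing $0$, $T^D = \inf\{t>0 : Z_t\notin D\}$ is the first exit time from $D$. For a simply connected domain $V$ containing $0$, $d(V) = \inf\{|z| : z\in\partial V\}$. *)

theory Defs
  imports "HOL-Probability.Probability"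
begin

(* Processes are indexed by real; only times t \<ge> 0 are constrained. *)
locale standard_brownian_motion = prob_space M
  for M :: "'a measure" and B :: "real \<Rightarrow> 'a \<Rightarrow> real" +
  assumes random_variable_B: "\<And>t. 0 \<le> t \<Longrightarrow> random_variable borel (B t)"
    and starts_at_0: "AE \<omega> in M. B 0 \<omega> = 0"
    and gaussian_increments: "\<And>s t. 0 \<le> s \<Longrightarrow> s < t \<Longrightarrow>
      distributed M lborel (\<lambda>\<omega>. B t \<omega> - B s \<omega>)
        (\<lambda>x. ennreal (normal_density 0 (sqrt (t - s)) x))"
    and indep_increments: "\<And>(\<tau> :: nat \<Rightarrow> real) n. 0 \<le> \<tau> 0 \<Longrightarrow> (\<And>i. i < n \<Longrightarrow> \<tau> i \<le> \<tau> (Suc i)) \<Longrightarrow>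
      indep_vars (\<lambda>_. borel) (\<lambda>i \<omega>. B (\<tau> (Suc i)) \<omega> - B (\<tau> i) \<omega>) {..<n}"
    and continuous_paths: "AE \<omega> in M. continuous_on {0..} (\<lambda>t. B t \<omega>)"

(* indep_coordinates is independence of the two coordinate processes, as random elements of
   the product space over all times, not merely of X_t and Y_t for each fixed t. *)
locale planar_brownian_motion = prob_space M
  for M :: "'a measure" and Z :: "real \<Rightarrow> 'a \<Rightarrow> complex" +
  assumes brownian_Re: "standard_brownian_motion M (\<lambda>t \<omega>. Re (Z t \<omega>))"
    and brownian_Im: "standard_brownian_motion M (\<lambda>t \<omega>. Im (Z t \<omega>))"
    and indep_coordinates: "indep_var
      (PiM {0..} (\<lambda>_. borel)) (\<lambda>\<omega>. \<lambda>t\<in>{0..}. Re (Z t \<omega>))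
      (PiM {0..} (\<lambda>_. borel)) (\<lambda>\<omega>. \<lambda>t\<in>{0..}. Im (Z t \<omega>))"

(* Valued in ereal so that the infimum is \<infinity> on paths that never leave D. *)
definition exit_time :: "(real \<Rightarrow> 'a \<Rightarrow> complex) \<Rightarrow> complex set \<Rightarrow> 'a \<Rightarrow> ereal" where
  "exit_time Z D \<omega> = Inf (ereal ` {t. 0 < t \<and> Z t \<omega> \<notin> D})"

(* Paths are only almost surely continuous, so the event need not lie in sets M, but for open D
   it lies in the completion. The two measures agree on sets M. *)
definition exit_prob :: "'a measure \<Rightarrow> (real \<Rightarrow> 'a \<Rightarrow> complex) \<Rightarrow> complex set \<Rightarrow> real \<Rightarrow> real" where
  "exit_prob M Z D t = measure (completion M) {\<omega> \<in> space M. exit_time Z D \<omega> < ereal t}"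

definition simply_connected_domain :: "complex set \<Rightarrow> bool" where
  "simply_connected_domain V \<longleftrightarrow> open V \<and> V \<noteq> {} \<and> connected V \<and> simply_connected V"

(* For V \<noteq> UNIV containing 0 the frontier is nonempty, so this is a genuine infimum. *)
definition boundary_dist :: "complex set \<Rightarrow> real" where
  "boundary_dist V = Inf {cmod z | z. z \<in> frontier V}"

end

theory Submission
  imports Defs
begin

text \<open>
  Lower bound for \<open>U\<close>: let \<open>e d\<close> with \<open>\<bar>e\<bar> = 1\<close> be a boundary point at minimal distance. If a path from \<open>0\<close>
  reaches the ray \<open>e [d, \<infinity>)\<close>, then the path together with its mirror image in the line \<open>\<real> e\<close> winds around
  \<open>e d\<close>, so one of the two leaves \<open>U\<close>: otherwise a continuous square root of \<open>w / e - d\<close> on \<open>U\<close>, continued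
  along both paths, would be imaginary at the start and real at the end. As the two paths have the same
  law, \<open>P(T\<^sup>U < t)\<close> is at least half the probability of reaching the ray, which by rotation invariance
  is not of smaller order than
  \<open>P(X\<^sub>t > a)\<close> for any \<open>a > d\<close>.

  Upper bound for \<open>W\<close>: to leave the disc of radius \<open>r = d(W)\<close> one coordinate must exceed \<open>b\<close> in
  absolute value for every \<open>b < r / \<surd>2\<close>, which by Levy's maximal inequality has probability at most \<open>8 P(X\<^sub>t > b)\<close>.
  Choosing \<open>a < b\<close>, the quotient of the two Gaussian tails tends to infinity.
\<close>

subsection \<open>Reflected paths and simply connected domains\<close>

text \<open>The complement of \<open>U\<close> may be arbitrarily thin near its closest boundary
  point, so passing beyond that point does not force an exit and no half-plane estimate is
  available. Pairing each path with its mirror image makes up for this at the cost of a factor 2.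
  Reaching the ray has the order of a Gaussian tail because of one explicit event with deterministic
  times \<open>s < T < t\<close>: the real part exceeds \<open>d + \<delta>\<close> at
  \<open>s\<close> and falls by at most \<delta> until \<open>T\<close>, while the imaginary part
  changes sign in between. By scaling, the sign change has a probability bounded below independently
  of \<open>t\<close>; with \<open>s\<close> close to \<open>t\<close>, such a fall is less likely
  than the excess. Stopping times and the strong Markov property are avoided in this way, and Levy's
  inequality on dyadic grids replaces the reflection principle. The constants lost on the way are
  harmless, since the quotient of the tails grows at least like \<open>exp (C / t)\<close> with
  \<open>C > 0\<close>.\<close>

lemma symmetric_paths_leave:
  fixes \<gamma> :: "real \<Rightarrow> complex"
  assumes V: "open V" "simply_connected V"
    and d: "0 < d" and e: "cmod e = 1" "e * of_real d \<notin> V"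
    and u: "0 \<le> u" and \<gamma>: "continuous_on {0..u} \<gamma>" "\<gamma> 0 = 0" "Im (\<gamma> u) = 0" "d \<le> Re (\<gamma> u)"
  shows "\<exists>v\<in>{0..u}. e * \<gamma> v \<notin> V \<or> e * cnj (\<gamma> v) \<notin> V"
proof (rule ccontr)
  assume "\<not> ?thesis"
  then have inV: "\<And>v. v \<in> {0..u} \<Longrightarrow> e * \<gamma> v \<in> V" "\<And>v. v \<in> {0..u} \<Longrightarrow> e * cnj (\<gamma> v) \<in> V"
    by auto
  have e0: "e \<noteq> 0" using e by auto
  have "continuous_on V (\<lambda>w. w / e - of_real d)"
    using e0 by (intro continuous_intros) auto
  moreover have "w / e - of_real d \<noteq> 0" if "w \<in> V" for w
    using that e e0 by (auto simp: field_simps)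
  ultimately have "\<exists>g. continuous_on V g \<and> (\<forall>w\<in>V. w / e - of_real d = (g w)^2)"
    by (rule continuous_sqrt_on_simply_connected[OF _ V(2) open_imp_locally_path_connected[OF V(1)]]) blast+
  then obtain g where g: "continuous_on V g" "\<And>w. w \<in> V \<Longrightarrow> w / e - of_real d = (g w)^2"
    by blast
  \<comment> \<open>Both are continuous square roots of \<open>\<gamma> v - d\<close>, the outer
    conjugation in \<open>k\<close> undoing the inner one. Hence \<open>h / k\<close> takes only the
    values 1 and -1 and is constant. At time 0 the square is \<open>- d < 0\<close>, so
    \<open>h 0\<close> is imaginary and \<open>k 0 = - h 0\<close>; at time \<open>u\<close> the
    square is real and nonnegative, so \<open>k u = h u\<close>, and the signs contradict each
    other.\<close>
  define h where "h v = g (e * \<gamma> v)" for v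
  define k where "k v = cnj (g (e * cnj (\<gamma> v)))" for v
  have h2: "(h v)^2 = \<gamma> v - of_real d" if "v \<in> {0..u}" for v
    using g(2)[OF inV(1)[OF that]] e0 by (simp add: h_def)
  have k2: "(k v)^2 = \<gamma> v - of_real d" if "v \<in> {0..u}" for v
  proof -
    have "(g (e * cnj (\<gamma> v)))^2 = cnj (\<gamma> v) - of_real d"
      using g(2)[OF inV(2)[OF that]] e0 by simp
    then have "cnj ((g (e * cnj (\<gamma> v)))^2) = cnj (cnj (\<gamma> v) - of_real d)" by (rule arg_cong)
    then show ?thesis by (simp add: k_def)
  qed
  \<comment> \<open>\<open>\<gamma> v = d\<close> would put the path at \<open>e * d\<close>,
    outside \<open>V\<close>. This includes the endpoint, where
    \<open>d \<le> Re (\<gamma> u)\<close> allows equality.\<close>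
  have nz: "\<gamma> v - of_real d \<noteq> 0" if "v \<in> {0..u}" for v
    using inV(1)[OF that] e by auto
  have k0: "k v \<noteq> 0" if "v \<in> {0..u}" for v
    using k2[OF that] nz[OF that] by auto
  have ch: "continuous_on {0..u} h"
    unfolding h_def using inV \<gamma>(1)
    by (intro continuous_on_compose2[OF g(1)] continuous_intros) auto
  have ck: "continuous_on {0..u} k"
    unfolding k_def using inV \<gamma>(1)
    by (intro continuous_on_cnj continuous_on_compose2[OF g(1)] continuous_intros) auto
  have "(\<lambda>v. h v / k v) ` {0..u} \<subseteq> {1, -1}"
  proof (rule image_subsetI)
    fix v assume v: "v \<in> {0..u}"
    have "(h v / k v)^2 = 1"
      using h2[OF v] k2[OF v] nz[OF v] by (simp add: power_divide)
    then show "h v / k v \<in> {1, -1}" by (simp add: power2_eq_1_iff)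
  qed
  then have "finite ((\<lambda>v. h v / k v) ` {0..u})" using finite_subset by blast
  moreover have "continuous_on {0..u} (\<lambda>v. h v / k v)"
    using ch ck k0 by (intro continuous_intros) auto
  ultimately have "(\<lambda>v. h v / k v) constant_on {0..u}"
    by (intro continuous_finite_range_constant) auto
  then have eq: "h 0 / k 0 = h u / k u"
    using u unfolding constant_on_def by force
  have in0: "0 \<in> {0..u}" "u \<in> {0..u}" using u by auto
  have "Re ((h 0)^2) = - d" "Im ((h 0)^2) = 0" using h2[OF in0(1)] \<gamma>(2) by auto
  then have R0: "Re (h 0) * Re (h 0) - Im (h 0) * Im (h 0) = - d" "Re (h 0) * Im (h 0) = 0"
    by (auto simp: power2_eq_square)
  have "Re (h 0) = 0"
  proof (rule ccontr)
    assume "Re (h 0) \<noteq> 0"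
    then have "Re (h 0) * Re (h 0) = - d" using R0 by simp
    then show False using d zero_le_square[of "Re (h 0)"] by linarith
  qed
  moreover have "k 0 = cnj (h 0)" by (simp add: h_def k_def \<gamma>(2))
  ultimately have 0: "h 0 = - k 0" by (simp add: complex_eq_iff)
  have cu: "cnj (\<gamma> u) = \<gamma> u" using \<gamma>(3) by (simp add: complex_eq_iff)
  have "Re ((h u)^2) \<ge> 0" "Im ((h u)^2) = 0" using h2[OF in0(2)] \<gamma> by auto
  then have Ru: "Re (h u) * Re (h u) - Im (h u) * Im (h u) \<ge> 0" "Re (h u) * Im (h u) = 0"
    by (auto simp: power2_eq_square)
  have "Im (h u) = 0"
  proof (rule ccontr)
    assume *: "Im (h u) \<noteq> 0"
    then have "Im (h u) * Im (h u) \<le> 0" using Ru by simp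
    then show False using * not_real_square_gt_zero[of "Im (h u)"] by linarith
  qed
  moreover have "k u = cnj (h u)" by (simp add: h_def k_def cu)
  ultimately have "h u = k u" by (simp add: complex_eq_iff)
  then show False using eq 0 k0[OF in0(1)] k0[OF in0(2)] by (auto simp: divide_minus_left)
qed

subsection \<open>Rotation invariance of the planar Gaussian\<close>

text \<open>With the sheared coordinate integrated innermost, the shear is a translation by a
  constant, under which Lebesgue measure is invariant.\<close>

lemma nn_integral_shear_fst:
  fixes h :: "real \<times> real \<Rightarrow> ennreal"
  assumes [measurable]: "h \<in> borel_measurable (lborel \<Otimes>\<^sub>M lborel)"
  shows "(\<integral>\<^sup>+z. h (fst z + c * snd z, snd z) \<partial>(lborel \<Otimes>\<^sub>M lborel)) = (\<integral>\<^sup>+z. h z \<partial>(lborel \<Otimes>\<^sub>M lborel))"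
proof -
  have "(\<integral>\<^sup>+z. h (fst z + c * snd z, snd z) \<partial>(lborel \<Otimes>\<^sub>M lborel)) = (\<integral>\<^sup>+y. (\<integral>\<^sup>+x. h (x + c * y, y) \<partial>lborel) \<partial>lborel)"
    by (subst lborel_pair.nn_integral_snd[symmetric]) auto
  also have "\<dots> = (\<integral>\<^sup>+y. (\<integral>\<^sup>+x. h (x, y) \<partial>lborel) \<partial>lborel)"
  proof (rule nn_integral_cong)
    fix y :: real
    show "(\<integral>\<^sup>+x. h (x + c * y, y) \<partial>lborel) = (\<integral>\<^sup>+x. h (x, y) \<partial>lborel)"
      using nn_integral_real_affine[of "\<lambda>x. h (x, y)" 1 "c * y"] by (simp add: add.commute)
  qed
  also have "\<dots> = (\<integral>\<^sup>+z. h z \<partial>(lborel \<Otimes>\<^sub>M lborel))"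
    by (subst lborel_pair.nn_integral_snd[symmetric]) auto
  finally show ?thesis .
qed

lemma nn_integral_shear_snd:
  fixes h :: "real \<times> real \<Rightarrow> ennreal"
  assumes [measurable]: "h \<in> borel_measurable (lborel \<Otimes>\<^sub>M lborel)"
  shows "(\<integral>\<^sup>+z. h (fst z, snd z + c * fst z) \<partial>(lborel \<Otimes>\<^sub>M lborel)) = (\<integral>\<^sup>+z. h z \<partial>(lborel \<Otimes>\<^sub>M lborel))"
proof -
  have "(\<integral>\<^sup>+z. h (fst z, snd z + c * fst z) \<partial>(lborel \<Otimes>\<^sub>M lborel)) = (\<integral>\<^sup>+x. (\<integral>\<^sup>+y. h (x, y + c * x) \<partial>lborel) \<partial>lborel)"
    by (subst lborel.nn_integral_fst[symmetric]) auto
  also have "\<dots> = (\<integral>\<^sup>+x. (\<integral>\<^sup>+y. h (x, y) \<partial>lborel) \<partial>lborel)"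
  proof (rule nn_integral_cong)
    fix x :: real
    show "(\<integral>\<^sup>+y. h (x, y + c * x) \<partial>lborel) = (\<integral>\<^sup>+y. h (x, y) \<partial>lborel)"
      using nn_integral_real_affine[of "\<lambda>y. h (x, y)" 1 "c * x"] by (simp add: add.commute)
  qed
  also have "\<dots> = (\<integral>\<^sup>+z. h z \<partial>(lborel \<Otimes>\<^sub>M lborel))"
    by (subst lborel.nn_integral_fst[symmetric]) auto
  finally show ?thesis .
qed

text \<open>A rotation other than the half turn is a composition of three shears.\<close>

lemma nn_integral_rotate:
  fixes h :: "real \<times> real \<Rightarrow> ennreal"
  assumes h: "h \<in> borel_measurable (lborel \<Otimes>\<^sub>M lborel)" and ab: "a\<^sup>2 + b\<^sup>2 = 1" "a \<noteq> -1"
  shows "(\<integral>\<^sup>+z. h (a * fst z - b * snd z, b * fst z + a * snd z) \<partial>(lborel \<Otimes>\<^sub>M lborel)) = (\<integral>\<^sup>+z. h z \<partial>(lborel \<Otimes>\<^sub>M lborel))"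
proof -
  note [measurable] = h
  \<comment> \<open>With \<open>a = cos \<theta>\<close> and \<open>b = sin \<theta>\<close> this is
    \<open>tan (\<theta> / 2)\<close>, which blows up exactly at the half turn. The three shears
    have the coefficients \<open>- m\<close>, \<open>b\<close>, \<open>- m\<close>.\<close>
  define m where "m = b / (1 + a)"
  have mb: "m * b = 1 - a" "m * (1 + a) = b"
    using ab by (auto simp: m_def field_simps power2_eq_square add_eq_0_iff)
  define h1 where "h1 z = h (fst z + (-m) * snd z, snd z)" for z
  define h2 where "h2 z = h1 (fst z, snd z + b * fst z)" for z
  have [measurable]: "h1 \<in> borel_measurable (lborel \<Otimes>\<^sub>M lborel)" unfolding h1_def by measurable
  have [measurable]: "h2 \<in> borel_measurable (lborel \<Otimes>\<^sub>M lborel)" unfolding h2_def by measurable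
  have "h2 (fst z + (-m) * snd z, snd z) = h (a * fst z - b * snd z, b * fst z + a * snd z)" for z
  proof -
    have 1: "snd z + b * (fst z - m * snd z) = b * fst z + (1 - m * b) * snd z"
      by (simp add: algebra_simps)
    have 2: "fst z - m * snd z - m * (b * fst z + a * snd z) = (1 - m * b) * fst z - (m * (1 + a)) * snd z"
      by (simp add: algebra_simps)
    show ?thesis unfolding h2_def h1_def using 1 2 mb by simp
  qed
  then show ?thesis
    using nn_integral_shear_fst[of h2 "-m"] nn_integral_shear_snd[of h1 b] nn_integral_shear_fst[of h "-m"]
    by (simp add: h1_def h2_def)
qed

text \<open>The law of a planar Brownian increment over a time step of length
  \<open>\<sigma>\<^sup>2\<close>.\<close>

definition gauss2 :: "real \<Rightarrow> complex measure" where
  "gauss2 \<sigma> = distr (density lborel (normal_density 0 \<sigma>) \<Otimes>\<^sub>M density lborel (normal_density 0 \<sigma>)) borel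
     (\<lambda>z. Complex (fst z) (snd z))"

lemma measurable_Complex_pair [measurable]:
  "(\<lambda>z. Complex (fst z) (snd z)) \<in> borel_measurable (borel \<Otimes>\<^sub>M borel)"
  unfolding Complex_eq by measurable

lemma normal_density_prod_eq:
  "normal_density 0 \<sigma> x * normal_density 0 \<sigma> y = exp (- (x\<^sup>2 + y\<^sup>2) / (2 * \<sigma>\<^sup>2)) / (2 * pi * \<sigma>\<^sup>2)"
proof -
  have "exp (- x\<^sup>2 / (2 * \<sigma>\<^sup>2)) * exp (- y\<^sup>2 / (2 * \<sigma>\<^sup>2)) = exp (- (x\<^sup>2 + y\<^sup>2) / (2 * \<sigma>\<^sup>2))"
    by (simp add: exp_add[symmetric] add_divide_distrib diff_divide_distrib)
  then show ?thesis by (simp add: normal_density_def power2_eq_square[of \<sigma>])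
qed

text \<open>The density is radial, so invariance under a linear isometry reduces to the same
  invariance of Lebesgue measure.\<close>

lemma emeasure_gauss2:
  assumes [arith]: "0 < \<sigma>" and [measurable]: "A \<in> sets borel"
  shows "emeasure (gauss2 \<sigma>) A = (\<integral>\<^sup>+z. ennreal (exp (- ((fst z)\<^sup>2 + (snd z)\<^sup>2) / (2 * \<sigma>\<^sup>2)) / (2 * pi * \<sigma>\<^sup>2)) *
     indicator A (Complex (fst z) (snd z)) \<partial>(lborel \<Otimes>\<^sub>M lborel))"
proof -
  interpret N: prob_space "density lborel (normal_density 0 \<sigma>)"
    by (rule prob_space_normal_density) simp
  have *: "density lborel (normal_density 0 \<sigma>) \<Otimes>\<^sub>M density lborel (normal_density 0 \<sigma>) =
    density (lborel \<Otimes>\<^sub>M lborel) (\<lambda>(x,y). ennreal (normal_density 0 \<sigma> x) * ennreal (normal_density 0 \<sigma> y))"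
    by (rule pair_measure_density) (auto intro: N.sigma_finite_measure_axioms lborel.sigma_finite_measure_axioms)
  have B: "(\<lambda>z. Complex (fst z) (snd z)) -` A \<inter> space (borel \<Otimes>\<^sub>M borel) \<in> sets (borel \<Otimes>\<^sub>M borel)"
    by measurable
  then have B: "(\<lambda>z. Complex (fst z) (snd z)) -` A \<in> sets (borel \<Otimes>\<^sub>M borel)"
    by (simp add: space_pair_measure)
  show ?thesis
    unfolding gauss2_def * by (simp add: emeasure_distr emeasure_density B)
      (auto intro!: nn_integral_cong simp: ennreal_mult'[symmetric] normal_density_prod_eq split: split_indicator)
qed

lemma sets_gauss2 [simp, measurable_cong]: "sets (gauss2 \<sigma>) = sets borel"
  by (simp add: gauss2_def)

lemma distr_gauss2_rotate_aux:
  assumes s: "0 < \<sigma>" and w: "cmod w = 1" "Re w \<noteq> -1"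
  shows "distr (gauss2 \<sigma>) borel ((*) w) = gauss2 \<sigma>"
proof (rule measure_eqI)
  fix A assume "A \<in> sets (distr (gauss2 \<sigma>) borel ((*) w))"
  then have [measurable]: "A \<in> sets borel" by simp
  have ab: "(Re w)\<^sup>2 + (Im w)\<^sup>2 = 1" using w by (simp add: cmod_def)
  define h :: "real \<times> real \<Rightarrow> ennreal" where
   "h z = ennreal (exp (- ((fst z)\<^sup>2 + (snd z)\<^sup>2) / (2 * \<sigma>\<^sup>2)) / (2 * pi * \<sigma>\<^sup>2)) *
     indicator A (Complex (fst z) (snd z))" for z
  have [measurable]: "h \<in> borel_measurable (lborel \<Otimes>\<^sub>M lborel)" unfolding h_def by measurable
  have *: "(Re w * x - Im w * y)\<^sup>2 + (Im w * x + Re w * y)\<^sup>2 = x\<^sup>2 + y\<^sup>2" for x y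
  proof -
    have "(Re w * x - Im w * y)\<^sup>2 + (Im w * x + Re w * y)\<^sup>2 = ((Re w)\<^sup>2 + (Im w)\<^sup>2) * (x\<^sup>2 + y\<^sup>2)" 
      by (simp add: power2_eq_square algebra_simps)
    then show ?thesis using ab by simp
  qed
  have [measurable]: "(*) w -` A \<in> sets borel"
    using measurable_sets[of "(*) w" borel borel A] by simp
  have "emeasure (distr (gauss2 \<sigma>) borel ((*) w)) A = emeasure (gauss2 \<sigma>) ((*) w -` A)"
    by (subst emeasure_distr) (auto simp: gauss2_def)
  also have "\<dots> = (\<integral>\<^sup>+z. h (Re w * fst z - Im w * snd z, Im w * fst z + Re w * snd z) \<partial>(lborel \<Otimes>\<^sub>M lborel))"
    unfolding emeasure_gauss2[OF s \<open>(*) w -` A \<in> sets borel\<close>] h_def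
    by (intro nn_integral_cong) (simp add: * indicator_def complex_eq_iff times_complex.code add.commute)
  also have "\<dots> = (\<integral>\<^sup>+z. h z \<partial>(lborel \<Otimes>\<^sub>M lborel))"
    by (rule nn_integral_rotate) (use ab w in auto)
  also have "\<dots> = emeasure (gauss2 \<sigma>) A" unfolding h_def using s by (simp add: emeasure_gauss2)
  finally show "emeasure (distr (gauss2 \<sigma>) borel ((*) w)) A = emeasure (gauss2 \<sigma>) A" .
qed simp

text \<open>Multiplying by \<open>w\<close> is multiplying twice by its principal square root, whose
  real part is nonnegative; so the half turn, which the shears do not reach, never has to be applied
  in one go.\<close>

lemma distr_gauss2_rotate:
  assumes s: "0 < \<sigma>" and w: "cmod w = 1"
  shows "distr (gauss2 \<sigma>) borel ((*) w) = gauss2 \<sigma>"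
proof -
  let ?v = "csqrt w"
  have "(cmod ?v)^2 = 1" using w by (metis norm_power power2_csqrt)
  then have v: "cmod ?v = 1" using norm_ge_zero[of ?v] by (simp only: power2_eq_1_iff) linarith
  have "Re ?v \<ge> 0" by (metis csqrt_principal less_eq_real_def)
  then have v2: "Re ?v \<noteq> -1" by linarith
  have "distr (gauss2 \<sigma>) borel ((*) w) = distr (distr (gauss2 \<sigma>) borel ((*) ?v)) borel ((*) ?v)"
    by (subst distr_distr) (auto simp: comp_def mult.assoc[symmetric] power2_eq_square[symmetric] intro!: arg_cong[where f="distr _ _"])
  also have "\<dots> = gauss2 \<sigma>" by (simp only: distr_gauss2_rotate_aux[OF s v v2])
  finally show ?thesis .
qed

lemma distr_gauss2_cnj:
  assumes s: "0 < \<sigma>"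
  shows "distr (gauss2 \<sigma>) borel cnj = gauss2 \<sigma>"
proof (rule measure_eqI)
  have [measurable]: "cnj \<in> borel_measurable borel" by (intro borel_measurable_continuous_onI continuous_intros)
  fix A assume "A \<in> sets (distr (gauss2 \<sigma>) borel cnj)"
  then have [measurable]: "A \<in> sets borel" by simp
  define h :: "real \<times> real \<Rightarrow> ennreal" where
   "h z = ennreal (exp (- ((fst z)\<^sup>2 + (snd z)\<^sup>2) / (2 * \<sigma>\<^sup>2)) / (2 * pi * \<sigma>\<^sup>2)) *
     indicator A (Complex (fst z) (snd z))" for z
  have [measurable]: "h \<in> borel_measurable (lborel \<Otimes>\<^sub>M lborel)" unfolding h_def by measurable
  have A': "cnj -` A \<in> sets borel"
    using measurable_sets[of cnj borel borel A] by simp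
  have "emeasure (distr (gauss2 \<sigma>) borel cnj) A = emeasure (gauss2 \<sigma>) (cnj -` A)"
    by (subst emeasure_distr) (auto simp: gauss2_def)
  also have "\<dots> = (\<integral>\<^sup>+z. h (fst z, - snd z) \<partial>(lborel \<Otimes>\<^sub>M lborel))"
    unfolding emeasure_gauss2[OF s A'] h_def
    by (intro nn_integral_cong) (simp add: indicator_def complex_cnj)
  also have "\<dots> = (\<integral>\<^sup>+x. (\<integral>\<^sup>+y. h (x, - y) \<partial>lborel) \<partial>lborel)"
    by (subst lborel.nn_integral_fst[symmetric]) auto
  also have "\<dots> = (\<integral>\<^sup>+x. (\<integral>\<^sup>+y. h (x, y) \<partial>lborel) \<partial>lborel)"
  proof (rule nn_integral_cong)
    fix x :: real
    show "(\<integral>\<^sup>+y. h (x, - y) \<partial>lborel) = (\<integral>\<^sup>+y. h (x, y) \<partial>lborel)"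
      using nn_integral_real_affine[of "\<lambda>y. h (x, y)" "-1" 0] by simp
  qed
  also have "\<dots> = (\<integral>\<^sup>+z. h z \<partial>(lborel \<Otimes>\<^sub>M lborel))"
    by (subst lborel.nn_integral_fst[symmetric]) auto
  also have "\<dots> = emeasure (gauss2 \<sigma>) A" unfolding h_def using s by (simp add: emeasure_gauss2)
  finally show "emeasure (distr (gauss2 \<sigma>) borel cnj) A = emeasure (gauss2 \<sigma>) A" .
qed simp

subsection \<open>Maximal inequality for Brownian motion\<close>

text \<open>Decompose by the first index \<open>k\<close> at which the partial sum exceeds
  \<open>a\<close>. This event \<open>A k\<close> depends on the first \<open>k\<close> terms only,
  so it is independent of the event \<open>D k\<close> that the remaining terms have a nonnegative
  sum, which has probability at least 1/2. On both events together the full sum exceeds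
  \<open>a\<close>.\<close>

lemma (in prob_space) levy_maximal_inequality:
  fixes X :: "nat \<Rightarrow> 'a \<Rightarrow> real"
  assumes ind: "indep_vars (\<lambda>_. borel) X {..<n}"
    and sym: "\<And>k. k \<le> n \<Longrightarrow> 1 / 2 \<le> prob {\<omega> \<in> space M. 0 \<le> (\<Sum>i\<in>{k..<n}. X i \<omega>)}"
  shows "prob {\<omega> \<in> space M. \<exists>k\<le>n. a < (\<Sum>i<k. X i \<omega>)} \<le> 2 * prob {\<omega> \<in> space M. a < (\<Sum>i<n. X i \<omega>)}"
proof -
  define S where "S k \<omega> = (\<Sum>i<k. X i \<omega>)" for k \<omega>
  define A where "A k = {\<omega> \<in> space M. a < S k \<omega> \<and> (\<forall>j\<in>{..<k}. S j \<omega> \<le> a)}" for k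
  define D where "D k = {\<omega> \<in> space M. 0 \<le> (\<Sum>i\<in>{k..<n}. X i \<omega>)}" for k
  have X: "X i \<in> borel_measurable M" if "i < n" for i
    using ind that by (auto simp: indep_vars_def)
  have Sm [measurable]: "S k \<in> borel_measurable M" if "k \<le> n" for k
    unfolding S_def using X that by (intro borel_measurable_sum) auto
  have Am: "A k \<in> events" if "k \<le> n" for k
  proof -
    have [measurable]: "S j \<in> borel_measurable M" if "j \<le> k" for j
      using Sm that \<open>k \<le> n\<close> by auto
    show ?thesis unfolding A_def
      by (intro sets.sets_Collect_conj sets.sets_Collect_finite_All) (auto intro: borel_measurable_le)
  qed
  have Dm: "D k \<in> events" for k
    unfolding D_def using X by (intro borel_measurable_le borel_measurable_sum) auto
  have indep: "prob (A k \<inter> D k) = prob (A k) * prob (D k)" if k: "k \<le> n" for k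
  proof -
    let ?P1 = "PiM {..<k} (\<lambda>_. borel :: real measure)" and ?P2 = "PiM {k..<n} (\<lambda>_. borel :: real measure)"
    let ?X1 = "\<lambda>\<omega>. restrict (\<lambda>i. X i \<omega>) {..<k}" and ?X2 = "\<lambda>\<omega>. restrict (\<lambda>i. X i \<omega>) {k..<n}"
    let ?C1 = "{x \<in> space ?P1. a < (\<Sum>i<k. x i) \<and> (\<forall>j\<in>{..<k}. (\<Sum>i<j. x i) \<le> a)}"
    let ?C2 = "{x \<in> space ?P2. 0 \<le> (\<Sum>i\<in>{k..<n}. x i)}"
    have iv: "indep_var ?P1 ?X1 ?P2 ?X2"
      using k by (intro indep_var_restrict[OF ind]) auto
    have m1: "(\<lambda>x. \<Sum>i<j. x i) \<in> borel_measurable ?P1" if "j \<le> k" for j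
      using that by (intro borel_measurable_sum measurable_component_singleton) auto
    have m2: "(\<lambda>x. \<Sum>i\<in>{k..<n}. x i) \<in> borel_measurable ?P2"
      by (intro borel_measurable_sum measurable_component_singleton) auto
    have C1: "?C1 \<in> sets ?P1"
      using m1 by (intro sets.sets_Collect_conj sets.sets_Collect_finite_All borel_measurable_less borel_measurable_le) auto
    have C2: "?C2 \<in> sets ?P2" using m2 by (intro borel_measurable_le) auto
    have "(\<lambda>\<omega>. (?X1 \<omega>, ?X2 \<omega>)) -` (?C1 \<times> ?C2) \<inter> space M = A k \<inter> D k"
      by (auto simp: A_def D_def S_def space_PiM PiE_def)
    moreover have "?X1 -` ?C1 \<inter> space M = A k"
      by (auto simp: A_def S_def space_PiM PiE_def)
    moreover have "?X2 -` ?C2 \<inter> space M = D k"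
      by (auto simp: D_def space_PiM PiE_def)
    ultimately show ?thesis using indep_varD[OF iv C1 C2] by simp
  qed
  have AD: "disjoint_family_on A {..n}"
    unfolding disjoint_family_on_def
  proof (intro ballI impI)
    fix k j :: nat assume "k \<noteq> j"
    then consider "k < j" | "j < k" by linarith
    then show "A k \<inter> A j = {}" by cases (auto simp: A_def, (meson lessThan_iff not_le)+)
  qed
  have un: "{\<omega> \<in> space M. \<exists>k\<le>n. a < S k \<omega>} = (\<Union>k\<in>{..n}. A k)"
  proof (intro equalityI subsetI)
    fix \<omega> assume "\<omega> \<in> {\<omega> \<in> space M. \<exists>k\<le>n. a < S k \<omega>}"
    then obtain k where k: "\<omega> \<in> space M" "k \<le> n" "a < S k \<omega>" by auto
    define l where "l = (LEAST k. a < S k \<omega>)"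
    have "a < S l \<omega>" unfolding l_def by (rule LeastI[of _ k]) (rule k)
    moreover have "\<forall>j<l. S j \<omega> \<le> a" 
      using not_less_Least[of _ "\<lambda>k. a < S k \<omega>"] unfolding l_def by (meson not_less)
    moreover have "l \<le> n" using k Least_le[of "\<lambda>k. a < S k \<omega>" k] by (auto simp: l_def)
    ultimately show "\<omega> \<in> (\<Union>k\<in>{..n}. A k)" using k by (auto simp: A_def)
  qed (auto simp: A_def)
  have "prob {\<omega> \<in> space M. \<exists>k\<le>n. a < S k \<omega>} = (\<Sum>k\<in>{..n}. prob (A k))"
    unfolding un using AD Am by (intro finite_measure_finite_Union) auto
  also have "\<dots> \<le> (\<Sum>k\<in>{..n}. 2 * prob (A k \<inter> D k))"
  proof (rule sum_mono)
    fix k assume "k \<in> {..n}"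
    then have "1/2 \<le> prob (D k)" unfolding D_def using sym by auto
    then have "prob (A k) * (1/2) \<le> prob (A k) * prob (D k)"
      by (rule mult_left_mono) simp
    then show "prob (A k) \<le> 2 * prob (A k \<inter> D k)" using indep \<open>k \<in> {..n}\<close> by simp
  qed
  also have "\<dots> = 2 * (\<Sum>k\<in>{..n}. prob (A k \<inter> D k))" by (simp add: sum_distrib_left)
  also have "(\<Sum>k\<in>{..n}. prob (A k \<inter> D k)) = prob (\<Union>k\<in>{..n}. A k \<inter> D k)"
    using AD Am Dm by (intro finite_measure_finite_Union[symmetric])
      (auto simp: disjoint_family_on_def)
  also have "\<dots> \<le> prob {\<omega> \<in> space M. a < S n \<omega>}"
  proof (rule finite_measure_mono)
    show "(\<Union>k\<in>{..n}. A k \<inter> D k) \<subseteq> {\<omega> \<in> space M. a < S n \<omega>}"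
    proof clarsimp
      fix \<omega> k assume k: "k \<le> n" "\<omega> \<in> A k" "\<omega> \<in> D k"
      have "S n \<omega> = S k \<omega> + (\<Sum>i\<in>{k..<n}. X i \<omega>)"
        unfolding S_def using k by (metis atLeast0LessThan le0 sum.atLeastLessThan_concat)
      then show "\<omega> \<in> space M \<and> a < S n \<omega>" using k by (auto simp: A_def D_def)
    qed
    show "{\<omega> \<in> space M. a < S n \<omega>} \<in> events" by measurable
  qed
  finally show ?thesis by (simp add: S_def)
qed

section \<open>Dyadic times in an interval\<close>

text \<open>Doubling the index embeds each level in the next, so events over the levels increase;
  both endpoints belong to every level.\<close>

definition dyadic_grid :: "real \<Rightarrow> real \<Rightarrow> nat \<Rightarrow> nat \<Rightarrow> real" where
  "dyadic_grid s T n k = s + (T - s) * (real k / 2 ^ n)"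

definition dyadic_times :: "real \<Rightarrow> real \<Rightarrow> real set" where
  "dyadic_times s T = (\<Union>n. dyadic_grid s T n ` {..2 ^ n})"

lemma countable_dyadic_times [simp]: "countable (dyadic_times s T)"
  by (auto simp: dyadic_times_def intro!: countable_UN countable_image)

lemma dyadic_grid_mem: "s \<le> T \<Longrightarrow> k \<le> 2 ^ n \<Longrightarrow> dyadic_grid s T n k \<in> {s..T}"
proof -
  assume "s \<le> T" "k \<le> 2 ^ n"
  then have "real k \<le> real (2 ^ n)" by (simp only: of_nat_le_iff)
  then have "real k / 2 ^ n \<le> 1" by simp
  then have "(T - s) * (real k / 2 ^ n) \<le> (T - s) * 1" using \<open>s \<le> T\<close> by (intro mult_left_mono) auto
  then show ?thesis using \<open>s \<le> T\<close> by (auto simp: dyadic_grid_def)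
qed

lemma dyadic_times_subset: "s \<le> T \<Longrightarrow> dyadic_times s T \<subseteq> {s..T}"
  unfolding dyadic_times_def using dyadic_grid_mem by blast

lemma dyadic_times_closure:
  assumes "s \<le> T" shows "{s..T} \<subseteq> closure (dyadic_times s T)"
proof
  fix u assume u: "u \<in> {s..T}"
  define r where "r = (if s = T then 0 else (u - s) / (T - s))"
  have r: "0 \<le> r" "r \<le> 1" "u = s + (T - s) * r" using u by (auto simp: r_def divide_simps)
  define k where "k n = nat \<lfloor>r * 2 ^ n\<rfloor>" for n :: nat
  have k1: "real (k n) \<le> r * 2 ^ n" and k2: "r * 2 ^ n - 1 < real (k n)" for n
    using r by (simp_all add: k_def)
  have kle: "k n \<le> 2 ^ n" for n
  proof -
    have "r * 2 ^ n \<le> 1 * 2 ^ n" using r by (intro mult_right_mono) auto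
    then have "real (k n) \<le> 2 ^ n" using k1[of n] by linarith
    then show ?thesis by (metis of_nat_le_iff of_nat_numeral of_nat_power)
  qed
  have "(\<lambda>n. real (k n) / 2 ^ n) \<longlonglongrightarrow> r"
  proof (rule tendsto_sandwich)
    have "r - (1/2) ^ n \<le> real (k n) / 2 ^ n" for n
    proof -
      have "(r * 2 ^ n - 1) / 2 ^ n \<le> real (k n) / 2 ^ n"
        using less_imp_le[OF k2[of n]] by (intro divide_right_mono) auto
      then show ?thesis by (simp add: diff_divide_distrib power_one_over)
    qed
    then show "\<forall>\<^sub>F n in sequentially. r - (1/2) ^ n \<le> real (k n) / 2 ^ n" by simp
    show "\<forall>\<^sub>F n in sequentially. real (k n) / 2 ^ n \<le> r"
      using k1 by (intro always_eventually allI) (simp add: field_simps)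
    have "(\<lambda>n. r - (1/2::real) ^ n) \<longlonglongrightarrow> r - 0"
      by (intro tendsto_intros LIMSEQ_realpow_zero) auto
    then show "(\<lambda>n. r - (1/2::real) ^ n) \<longlonglongrightarrow> r" by simp
  qed simp
  then have "(\<lambda>n. dyadic_grid s T n (k n)) \<longlonglongrightarrow> u"
    unfolding dyadic_grid_def r(3) by (intro tendsto_intros)
  moreover have "dyadic_grid s T n (k n) \<in> dyadic_times s T" for n
    using kle by (auto simp: dyadic_times_def)
  ultimately show "u \<in> closure (dyadic_times s T)" unfolding closure_sequential
    by (intro exI[of _ "\<lambda>n. dyadic_grid s T n (k n)"] conjI allI)
qed

text \<open>Carries bounds from countably many times, where they define measurable events, to the
  whole of a continuous path.\<close>

lemma dyadic_times_le_extend: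
  fixes f :: "real \<Rightarrow> real"
  assumes "s \<le> T" "continuous_on {s..T} f" "\<And>q. q \<in> dyadic_times s T \<Longrightarrow> f q \<le> a" "u \<in> {s..T}"
  shows "f u \<le> a"
proof -
  have "closure (dyadic_times s T) \<subseteq> {s..T}"
    using dyadic_times_subset[OF assms(1)] by (intro closure_minimal) auto
  then have "continuous_on (closure (dyadic_times s T)) f" using assms(2) continuous_on_subset by blast
  then show ?thesis
    using continuous_le_on_closure[of "dyadic_times s T" f u a] assms dyadic_times_closure[OF assms(1)] by auto
qed

text \<open>In this normalisation the probability that a linear Brownian motion exceeds
  \<open>a\<close> at time \<open>t > 0\<close> is \<open>normal_tail (a / sqrt t)\<close>, so a
  single decreasing function carries all estimates.\<close>

definition normal_tail :: "real \<Rightarrow> real" where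
  "normal_tail x = measure (density lborel std_normal_density) {x<..}"

section \<open>One-sided estimates for linear Brownian motion\<close>

context standard_brownian_motion
begin

text \<open>Turns upper one-sided estimates into lower ones and provides the symmetry of the
  increments.\<close>

lemma uminus: "standard_brownian_motion M (\<lambda>t \<omega>. - B t \<omega>)"
proof unfold_locales
  fix t :: real assume "0 \<le> t"
  then show "random_variable borel (\<lambda>\<omega>. - B t \<omega>)" using random_variable_B by simp
next
  show "AE \<omega> in M. - B 0 \<omega> = 0" using starts_at_0 by simp
next
  fix s t :: real assume st: "0 \<le> s" "s < t"
  show "distributed M lborel (\<lambda>\<omega>. - B t \<omega> - - B s \<omega>) (\<lambda>x. ennreal (normal_density 0 (sqrt (t - s)) x))"
    using normal_density_affine[OF gaussian_increments[OF st], of "-1" 0] st by (simp add: algebra_simps)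
next
  fix \<tau> :: "nat \<Rightarrow> real" and n
  assume "0 \<le> \<tau> 0" "\<And>i. i < n \<Longrightarrow> \<tau> i \<le> \<tau> (Suc i)"
  from indep_vars_compose2[OF indep_increments[OF this], where Y = "\<lambda>_ x. - x" and N = "\<lambda>_. borel"]
  show "indep_vars (\<lambda>_. borel) (\<lambda>i \<omega>. - B (\<tau> (Suc i)) \<omega> - - B (\<tau> i) \<omega>) {..<n}"
    by (simp add: algebra_simps)
next
  show "AE \<omega> in M. continuous_on {0..} (\<lambda>t. - B t \<omega>)"
    using continuous_paths by eventually_elim (intro continuous_intros)
qed

lemma prob_increment_greater:
  assumes st: "0 \<le> s" "s < t"
  shows "prob {\<omega> \<in> space M. a < B t \<omega> - B s \<omega>} = normal_tail (a / sqrt (t - s))"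
proof -
  let ?Y = "\<lambda>\<omega>. (B t \<omega> - B s \<omega> - 0) / sqrt (t - s)"
  have D: "distributed M lborel ?Y std_normal_density"
    using gaussian_increments[OF st] st by (subst normal_standard_normal_convert[symmetric]) auto
  have Ym: "?Y \<in> borel_measurable M" using distributed_measurable[OF D] by simp
  have "prob {\<omega> \<in> space M. a < B t \<omega> - B s \<omega>} = prob (?Y -` {a / sqrt (t - s) <..} \<inter> space M)"
    using st by (intro arg_cong[where f=prob]) (auto simp: divide_strict_right_mono divide_less_cancel)
  also have "\<dots> = measure (distr M lborel ?Y) {a / sqrt (t - s) <..}"
    using Ym by (subst measure_distr) auto
  also have "\<dots> = normal_tail (a / sqrt (t - s))"
    unfolding distributed_distr_eq_density[OF D] normal_tail_def ..
  finally show ?thesis .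
qed

text \<open>By symmetry an increment is positive with the same probability as negative. This is the
  hypothesis \<open>sym\<close> of Levy's inequality; the case \<open>s = t\<close> occurs there as
  the empty sum at \<open>k = n\<close>.\<close>

lemma prob_increment_nonneg:
  assumes st: "0 \<le> s" "s \<le> t"
  shows "1 / 2 \<le> prob {\<omega> \<in> space M. 0 \<le> B t \<omega> - B s \<omega>}"
proof (cases "s = t")
  case True
  then show ?thesis by (simp add: prob_space)
next
  case False
  then have st: "0 \<le> s" "s < t" using st by auto
  interpret m: standard_brownian_motion M "\<lambda>t \<omega>. - B t \<omega>" by (rule uminus)
  have [measurable]: "random_variable borel (B s)" "random_variable borel (B t)"
    using random_variable_B st by auto
  let ?P = "{\<omega> \<in> space M. 0 < B t \<omega> - B s \<omega>}" and ?N = "{\<omega> \<in> space M. 0 \<le> B t \<omega> - B s \<omega>}"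
  have "prob ?P = prob {\<omega> \<in> space M. 0 < - B t \<omega> - - B s \<omega>}"
    using prob_increment_greater[OF st, of 0] m.prob_increment_greater[OF st, of 0] by simp
  also have "{\<omega> \<in> space M. 0 < - B t \<omega> - - B s \<omega>} = space M - ?N" by auto
  also have "prob \<dots> = 1 - prob ?N" by (rule prob_compl) measurable
  finally have "prob ?P = 1 - prob ?N" .
  moreover have "prob ?P \<le> prob ?N" by (rule finite_measure_mono) auto
  ultimately show ?thesis by simp
qed

text \<open>Levy's inequality on each grid gives a bound independent of the level, because every
  grid ends at \<open>T\<close>. The levels then increase to all dyadic times.\<close>

lemma maximal_inequality:
  assumes sT: "0 \<le> s" "s < T"
  shows "prob {\<omega> \<in> space M. \<exists>q\<in>dyadic_times s T. a < B q \<omega> - B s \<omega>} \<le> 2 * normal_tail (a / sqrt (T - s))"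
proof -
  define E where "E n = {\<omega> \<in> space M. \<exists>k\<le>2 ^ n. a < B (dyadic_grid s T n k) \<omega> - B s \<omega>}" for n
  have Bm: "random_variable borel (B (dyadic_grid s T n k))" if "k \<le> 2 ^ n" for n k
    using dyadic_grid_mem[OF less_imp_le[OF sT(2)] that] sT by (intro random_variable_B) auto
  have Bs: "random_variable borel (B s)" using random_variable_B sT by auto
  have Em: "E n \<in> events" for n
  proof -
    have "E n = (\<Union>k\<in>{..2 ^ n}. {\<omega> \<in> space M. a < B (dyadic_grid s T n k) \<omega> - B s \<omega>})"
      by (auto simp: E_def)
    also have "\<dots> \<in> events"
      using Bm Bs by (intro sets.finite_UN borel_measurable_less borel_measurable_diff) auto
    finally show ?thesis .
  qed
  have "incseq E"
  proof (rule incseq_SucI, rule subsetI)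
    fix n \<omega> assume "\<omega> \<in> E n"
    then obtain k where k: "\<omega> \<in> space M" "k \<le> 2 ^ n" "a < B (dyadic_grid s T n k) \<omega> - B s \<omega>"
      by (auto simp: E_def)
    have "dyadic_grid s T (Suc n) (2 * k) = dyadic_grid s T n k" by (simp add: dyadic_grid_def)
    with k show "\<omega> \<in> E (Suc n)" by (auto simp: E_def intro!: exI[of _ "2 * k"])
  qed
  have bound: "prob (E n) \<le> 2 * normal_tail (a / sqrt (T - s))" for n
  proof -
    let ?\<tau> = "dyadic_grid s T n"
    let ?X = "\<lambda>i \<omega>. B (?\<tau> (Suc i)) \<omega> - B (?\<tau> i) \<omega>"
    have mono: "?\<tau> i \<le> ?\<tau> j" if "i \<le> j" for i j
      using that sT by (auto simp: dyadic_grid_def intro!: mult_left_mono divide_right_mono)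
    have \<tau>0: "?\<tau> 0 = s" and \<tau>n: "?\<tau> (2 ^ n) = T" by (auto simp: dyadic_grid_def)
    have tel: "(\<Sum>i\<in>{k..<j}. ?X i \<omega>) = B (?\<tau> j) \<omega> - B (?\<tau> k) \<omega>" if "k \<le> j" for k j \<omega>
      using sum_Suc_diff'[OF that, of "\<lambda>i. B (?\<tau> i) \<omega>"] by simp
    have tel0: "(\<Sum>i<j. ?X i \<omega>) = B (?\<tau> j) \<omega> - B s \<omega>" for j \<omega>
      using tel[of 0 j \<omega>] \<tau>0 by (simp add: atLeast0LessThan)
    have "prob {\<omega> \<in> space M. \<exists>k\<le>2 ^ n. a < (\<Sum>i<k. ?X i \<omega>)} \<le> 2 * prob {\<omega> \<in> space M. a < (\<Sum>i<2 ^ n. ?X i \<omega>)}"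
    proof (rule levy_maximal_inequality)
      show "indep_vars (\<lambda>_. borel) ?X {..<2 ^ n}"
        using mono \<tau>0 sT by (intro indep_increments) auto
      fix k :: nat assume k: "k \<le> 2 ^ n"
      have "0 \<le> ?\<tau> k" "?\<tau> k \<le> T" using mono[of 0 k] mono[OF k] \<tau>0 \<tau>n sT by auto
      then show "1 / 2 \<le> prob {\<omega> \<in> space M. 0 \<le> (\<Sum>i\<in>{k..<2 ^ n}. ?X i \<omega>)}"
        unfolding tel[OF k] \<tau>n by (rule prob_increment_nonneg)
    qed
    then show ?thesis
      unfolding tel0 \<tau>n prob_increment_greater[OF sT] E_def .
  qed
  have "(\<lambda>n. prob (E n)) \<longlonglongrightarrow> prob (\<Union>n. E n)"
    using Em \<open>incseq E\<close> by (intro finite_Lim_measure_incseq) auto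
  then have "prob (\<Union>n. E n) \<le> 2 * normal_tail (a / sqrt (T - s))"
    by (rule LIMSEQ_le_const2) (use bound in auto)
  moreover have "(\<Union>n. E n) = {\<omega> \<in> space M. \<exists>q\<in>dyadic_times s T. a < B q \<omega> - B s \<omega>}"
    by (auto simp: E_def dyadic_times_def)
  ultimately show ?thesis by simp
qed

end

subsection \<open>Invariance of the path law under isometries\<close>

text \<open>The events \<open>X i \<in> A\<close> and \<open>Y i \<in> B\<close> taken jointly form
  an intersection-stable generator for the pair. Their probabilities factor first between the two
  families, by \<open>XY\<close>, and then within each family.\<close>

lemma (in prob_space) indep_vars_Pair:
  assumes I: "finite I" and X: "indep_vars N X I" and Y: "indep_vars N Y I"
    and XY: "indep_var (PiM I N) (\<lambda>\<omega>. \<lambda>i\<in>I. X i \<omega>) (PiM I N) (\<lambda>\<omega>. \<lambda>i\<in>I. Y i \<omega>)"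
  shows "indep_vars (\<lambda>i. N i \<Otimes>\<^sub>M N i) (\<lambda>i \<omega>. (X i \<omega>, Y i \<omega>)) I"
proof -
  define F where "F i = {X i -` A \<inter> (Y i -` B) \<inter> space M | A B. A \<in> sets (N i) \<and> B \<in> sets (N i)}" for i
  have Xm: "X i \<in> measurable M (N i)" and Ym: "Y i \<in> measurable M (N i)" if "i \<in> I" for i
    using X Y that by (auto simp: indep_vars_def)
  have prob_Inter: "prob (\<Inter>j\<in>J. X j -` A j \<inter> (Y j -` B j) \<inter> space M) =
      (\<Prod>j\<in>J. prob (X j -` A j \<inter> space M) * prob (Y j -` B j \<inter> space M))"
    if J: "J \<noteq> {}" "J \<subseteq> I" and AB: "\<And>j. j \<in> J \<Longrightarrow> A j \<in> sets (N j)" "\<And>j. j \<in> J \<Longrightarrow> B j \<in> sets (N j)" for J A B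
  proof -
    have fin: "finite J" using J(2) I finite_subset by auto
    let ?A = "prod_emb I N J (Pi\<^sub>E J A)" and ?B = "prod_emb I N J (Pi\<^sub>E J B)"
    have sets: "?A \<in> sets (PiM I N)" "?B \<in> sets (PiM I N)"
      using J fin AB by (auto intro!: sets_PiM_I)
    have eqA: "(\<lambda>\<omega>. \<lambda>i\<in>I. X i \<omega>) -` ?A \<inter> space M = (\<Inter>j\<in>J. X j -` A j \<inter> space M)"
      using J Xm[THEN measurable_space] by (auto simp: prod_emb_def PiE_iff subset_eq) 
    have eqB: "(\<lambda>\<omega>. \<lambda>i\<in>I. Y i \<omega>) -` ?B \<inter> space M = (\<Inter>j\<in>J. Y j -` B j \<inter> space M)"
      using J Ym[THEN measurable_space] by (auto simp: prod_emb_def PiE_iff subset_eq) 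
    have "(\<Inter>j\<in>J. X j -` A j \<inter> (Y j -` B j) \<inter> space M) =
      ((\<lambda>\<omega>. \<lambda>i\<in>I. X i \<omega>) -` ?A \<inter> space M) \<inter> ((\<lambda>\<omega>. \<lambda>i\<in>I. Y i \<omega>) -` ?B \<inter> space M)"
      unfolding eqA eqB using J(1) by auto
    also have "\<dots> = (\<lambda>\<omega>. (\<lambda>i\<in>I. X i \<omega>, \<lambda>i\<in>I. Y i \<omega>)) -` (?A \<times> ?B) \<inter> space M"
      by auto
    finally have "prob (\<Inter>j\<in>J. X j -` A j \<inter> (Y j -` B j) \<inter> space M) =
       prob (\<Inter>j\<in>J. X j -` A j \<inter> space M) * prob (\<Inter>j\<in>J. Y j -` B j \<inter> space M)"
      using indep_varD[OF XY sets] unfolding eqA eqB by simp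
    moreover have "prob (\<Inter>j\<in>J. X j -` A j \<inter> space M) = (\<Prod>j\<in>J. prob (X j -` A j \<inter> space M))"
      using X J fin AB unfolding indep_vars_def2
      by (intro indep_setsD[where F="\<lambda>i. {X i -` A \<inter> space M | A. A \<in> sets (N i)}" and I=I]) auto
    moreover have "prob (\<Inter>j\<in>J. Y j -` B j \<inter> space M) = (\<Prod>j\<in>J. prob (Y j -` B j \<inter> space M))"
      using Y J fin AB unfolding indep_vars_def2
      by (intro indep_setsD[where F="\<lambda>i. {Y i -` A \<inter> space M | A. A \<in> sets (N i)}" and I=I]) auto
    ultimately show ?thesis by (simp add: prod.distrib)
  qed
  have "indep_sets F I"
  proof (rule indep_setsI)
    fix i assume i: "i \<in> I"
    show "F i \<subseteq> events"
    proof
      fix S assume "S \<in> F i"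
      then obtain A B where S: "S = (X i -` A \<inter> space M) \<inter> (Y i -` B \<inter> space M)" "A \<in> sets (N i)" "B \<in> sets (N i)"
        by (auto simp: F_def)
      show "S \<in> events" unfolding S(1)
        by (intro sets.Int measurable_sets[OF Xm[OF i] S(2)] measurable_sets[OF Ym[OF i] S(3)])
    qed
  next
    fix A J assume J: "J \<noteq> {}" "J \<subseteq> I" "finite J" and A: "\<forall>j\<in>J. A j \<in> F j"
    then have "\<forall>j\<in>J. \<exists>B C. A j = X j -` B \<inter> (Y j -` C) \<inter> space M \<and> B \<in> sets (N j) \<and> C \<in> sets (N j)"
      by (auto simp: F_def)
    then obtain B C where BC: "\<And>j. j \<in> J \<Longrightarrow> A j = X j -` B j \<inter> (Y j -` C j) \<inter> space M"
       "\<And>j. j \<in> J \<Longrightarrow> B j \<in> sets (N j)" "\<And>j. j \<in> J \<Longrightarrow> C j \<in> sets (N j)"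
      by metis
    have "prob (\<Inter>j\<in>J. A j) = prob (\<Inter>j\<in>J. X j -` B j \<inter> (Y j -` C j) \<inter> space M)"
      using BC(1) by (intro arg_cong[where f=prob]) auto
    also have "\<dots> = (\<Prod>j\<in>J. prob (X j -` B j \<inter> space M) * prob (Y j -` C j \<inter> space M))"
      by (rule prob_Inter[OF J(1,2) BC(2,3)])
    also have "\<dots> = (\<Prod>j\<in>J. prob (A j))"
    proof (rule prod.cong[OF refl])
      fix j assume j: "j \<in> J"
      show "prob (X j -` B j \<inter> space M) * prob (Y j -` C j \<inter> space M) = prob (A j)"
        using prob_Inter[of "{j}" B C] j J BC by auto
    qed
    finally show "prob (\<Inter>j\<in>J. A j) = (\<Prod>j\<in>J. prob (A j))" .
  qed
  then have "indep_sets (\<lambda>i. sigma_sets (space M) (F i)) I"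
  proof (rule indep_sets_sigma)
    fix i
    show "Int_stable (F i)"
    proof (rule Int_stableI)
      fix S T assume "S \<in> F i" "T \<in> F i"
      then obtain A B A' B' where "S = X i -` A \<inter> (Y i -` B) \<inter> space M" "T = X i -` A' \<inter> (Y i -` B') \<inter> space M"
        "A \<in> sets (N i)" "B \<in> sets (N i)" "A' \<in> sets (N i)" "B' \<in> sets (N i)"
        by (auto simp: F_def)
      then have "S \<inter> T = X i -` (A \<inter> A') \<inter> (Y i -` (B \<inter> B')) \<inter> space M" "A \<inter> A' \<in> sets (N i)" "B \<inter> B' \<in> sets (N i)"
        by auto
      then show "S \<inter> T \<in> F i" unfolding F_def by blast
    qed
  qed
  then have "indep_sets (\<lambda>i. {(\<lambda>\<omega>. (X i \<omega>, Y i \<omega>)) -` A \<inter> space M | A. A \<in> sets (N i \<Otimes>\<^sub>M N i)}) I"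
  proof (rule indep_sets_mono_sets)
    fix i assume i: "i \<in> I"
    let ?G = "{a \<times> b |a b. a \<in> sets (N i) \<and> b \<in> sets (N i)}"
    let ?p = "\<lambda>\<omega>. (X i \<omega>, Y i \<omega>)"
    have sp: "?p \<in> space M \<rightarrow> space (N i) \<times> space (N i)"
      using measurable_space[OF Xm[OF i]] measurable_space[OF Ym[OF i]] by auto
    have "{?p -` A \<inter> space M | A. A \<in> sigma_sets (space (N i) \<times> space (N i)) ?G} =
       sigma_sets (space M) {?p -` A \<inter> space M | A. A \<in> ?G}"
      by (rule sigma_sets_vimage_commute[OF sp])
    then have eq: "{?p -` A \<inter> space M | A. A \<in> sets (N i \<Otimes>\<^sub>M N i)} = sigma_sets (space M) {?p -` A \<inter> space M | A. A \<in> ?G}"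
      unfolding sets_pair_measure .
    have "{?p -` A \<inter> space M | A. A \<in> ?G} \<subseteq> F i"
    proof clarify
      fix a b assume "a \<in> sets (N i)" "b \<in> sets (N i)"
      then show "?p -` (a \<times> b) \<inter> space M \<in> F i"
        unfolding F_def by (intro CollectI exI[of _ a] exI[of _ b]) auto
    qed
    then show "{?p -` A \<inter> space M | A. A \<in> sets (N i \<Otimes>\<^sub>M N i)} \<subseteq> sigma_sets (space M) (F i)"
      unfolding eq by (rule sigma_sets_mono')
  qed
  then show ?thesis
    unfolding indep_vars_def2 using measurable_Pair[OF Xm Ym] by blast
qed

text \<open>Time 0 is included because path values are rebuilt from increments starting there, and
  the grid is strictly increasing because the Gaussian law of an increment is given only for a
  positive time step.\<close>

lemma finite_times_grid:
  fixes J :: "real set"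
  assumes "finite J" "J \<subseteq> {0..}"
  obtains n and \<tau> :: "nat \<Rightarrow> real" where "0 < n" "\<tau> 0 = 0" "\<And>i. i < n \<Longrightarrow> \<tau> i < \<tau> (Suc i)" "J \<subseteq> \<tau> ` {..n}"
proof -
  \<comment> \<open>The time 1 guarantees a second grid point, hence \<open>0 < n\<close> and a
    nonempty family of increments.\<close>
  define S where "S = insert 0 (insert 1 J)"
  have S: "finite S" "0 \<in> S" "1 \<in> S" "J \<subseteq> S" "S \<subseteq> {0..}" using assms by (auto simp: S_def)
  define L where "L = sorted_list_of_set S"
  have L: "sorted_wrt (<) L" "set L = S" using S by (simp_all add: L_def)
  have "L \<noteq> []" using L(2) S(2) by auto
  obtain k where k: "k < length L" "L ! k = 0" using L(2) S(2) by (metis in_set_conv_nth)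
  have "L ! 0 \<ge> 0" using S(5) L(2) nth_mem[of 0 L] \<open>L \<noteq> []\<close> by auto
  then have "k = 0" using sorted_wrt_nth_less[OF L(1), of 0 k] k by (cases k) auto
  have "length L = card S" by (simp add: L_def)
  moreover have "card {0, 1::real} \<le> card S" using S by (intro card_mono) auto
  ultimately have len: "2 \<le> length L" by simp
  show ?thesis
  proof
    show "0 < length L - 1" using len by simp
    show "L ! 0 = 0" using k \<open>k = 0\<close> by simp
    show "L ! i < L ! Suc i" if "i < length L - 1" for i
      using that by (intro sorted_wrt_nth_less[OF L(1)]) auto
    show "J \<subseteq> (!) L ` {..length L - 1}"
    proof
      fix j assume "j \<in> J"
      then have "j \<in> set L" using L S by auto
      then obtain i where "i < length L" "j = L ! i" by (auto simp: in_set_conv_nth)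
      then show "j \<in> (!) L ` {..length L - 1}" by (auto intro!: imageI)
    qed
  qed
qed

abbreviation path_space :: "(real \<Rightarrow> complex) measure" where
  "path_space \<equiv> PiM {0..} (\<lambda>_. borel)"

context planar_brownian_motion
begin

sublocale Re: standard_brownian_motion M "\<lambda>t \<omega>. Re (Z t \<omega>)" by (rule brownian_Re)
sublocale Im: standard_brownian_motion M "\<lambda>t \<omega>. Im (Z t \<omega>)" by (rule brownian_Im)

lemma random_variable_Z [measurable]: "0 \<le> t \<Longrightarrow> random_variable borel (Z t)"
  using Re.random_variable_B Im.random_variable_B borel_measurable_complex_iff by blast

lemma starts_at_0: "AE \<omega> in M. Z 0 \<omega> = 0"
  using Re.starts_at_0 Im.starts_at_0 by eventually_elim (simp add: complex_eq_iff)

lemma continuous_paths: "AE \<omega> in M. continuous_on {0..} (\<lambda>t. Z t \<omega>)"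
  using Re.continuous_paths Im.continuous_paths
proof eventually_elim
  case (elim \<omega>)
  then have "continuous_on {0..} (\<lambda>t. Complex (Re (Z t \<omega>)) (Im (Z t \<omega>)))"
    by (rule continuous_on_Complex)
  then show ?case by simp
qed

lemma prob_Re_Im_independent:
  assumes "C \<in> sets (PiM {0..} (\<lambda>_. borel :: real measure))" "D \<in> sets (PiM {0..} (\<lambda>_. borel :: real measure))"
  shows "prob {\<omega> \<in> space M. (\<lambda>t\<in>{0..}. Re (Z t \<omega>)) \<in> C \<and> (\<lambda>t\<in>{0..}. Im (Z t \<omega>)) \<in> D} =
    prob {\<omega> \<in> space M. (\<lambda>t\<in>{0..}. Re (Z t \<omega>)) \<in> C} * prob {\<omega> \<in> space M. (\<lambda>t\<in>{0..}. Im (Z t \<omega>)) \<in> D}"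
proof -
  have "{\<omega> \<in> space M. (\<lambda>t\<in>{0..}. Re (Z t \<omega>)) \<in> C \<and> (\<lambda>t\<in>{0..}. Im (Z t \<omega>)) \<in> D} =
    (\<lambda>\<omega>. (\<lambda>t\<in>{0..}. Re (Z t \<omega>), \<lambda>t\<in>{0..}. Im (Z t \<omega>))) -` (C \<times> D) \<inter> space M" by auto
  moreover have "{\<omega> \<in> space M. (\<lambda>t\<in>{0..}. Re (Z t \<omega>)) \<in> C} = (\<lambda>\<omega>. \<lambda>t\<in>{0..}. Re (Z t \<omega>)) -` C \<inter> space M"
    "{\<omega> \<in> space M. (\<lambda>t\<in>{0..}. Im (Z t \<omega>)) \<in> D} = (\<lambda>\<omega>. \<lambda>t\<in>{0..}. Im (Z t \<omega>)) -` D \<inter> space M" by auto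
  ultimately show ?thesis using indep_varD[OF indep_coordinates assms] by simp
qed

lemma distr_increment:
  assumes st: "0 \<le> s" "s < t"
  shows "distr M borel (\<lambda>\<omega>. Z t \<omega> - Z s \<omega>) = gauss2 (sqrt (t - s))"
proof -
  let ?X = "\<lambda>\<omega>. Re (Z t \<omega>) - Re (Z s \<omega>)" and ?Y = "\<lambda>\<omega>. Im (Z t \<omega>) - Im (Z s \<omega>)"
  have [measurable]: "random_variable borel (Z t)" "random_variable borel (Z s)" using st by auto
  let ?D = "\<lambda>x::real \<Rightarrow> real. x t - x s"
  have "?D \<in> borel_measurable (PiM {0..} (\<lambda>_. borel))"
    using st by (intro borel_measurable_diff measurable_component_singleton) auto
  from indep_var_compose[OF indep_coordinates this this]
  have "indep_var borel ?X borel ?Y"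
    using st by (simp add: comp_def)
  then have eq: "distr M borel ?X \<Otimes>\<^sub>M distr M borel ?Y = distr M (borel \<Otimes>\<^sub>M borel) (\<lambda>\<omega>. (?X \<omega>, ?Y \<omega>))"
    unfolding indep_var_distribution_eq by auto
  have X: "distr M borel ?X = density lborel (normal_density 0 (sqrt (t - s)))"
    using distributed_distr_eq_density[OF Re.gaussian_increments[OF st]]
    by (subst distr_cong[OF refl sets_lborel[symmetric] refl]) auto
  have Y: "distr M borel ?Y = density lborel (normal_density 0 (sqrt (t - s)))"
    using distributed_distr_eq_density[OF Im.gaussian_increments[OF st]]
    by (subst distr_cong[OF refl sets_lborel[symmetric] refl]) auto
  have "gauss2 (sqrt (t - s)) = distr (distr M (borel \<Otimes>\<^sub>M borel) (\<lambda>\<omega>. (?X \<omega>, ?Y \<omega>))) borel (\<lambda>z. Complex (fst z) (snd z))"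
    unfolding gauss2_def eq[symmetric] X Y ..
  also have "\<dots> = distr M borel (\<lambda>\<omega>. Z t \<omega> - Z s \<omega>)"
    by (subst distr_distr) (auto simp: comp_def complex_eq_iff intro!: distr_cong)
  finally show ?thesis ..
qed

text \<open>Independence of the coordinates as processes is applied to the two vectors of all
  increments; independence at each single time would not give this.\<close>

lemma indep_increments:
  assumes \<tau>: "0 \<le> \<tau> 0" "\<And>i. i < n \<Longrightarrow> \<tau> i \<le> \<tau> (Suc i)"
  shows "indep_vars (\<lambda>_. borel) (\<lambda>i \<omega>. Z (\<tau> (Suc i)) \<omega> - Z (\<tau> i) \<omega>) {..<n}"
proof -
  let ?X = "\<lambda>i \<omega>. Re (Z (\<tau> (Suc i)) \<omega>) - Re (Z (\<tau> i) \<omega>)" and ?Y = "\<lambda>i \<omega>. Im (Z (\<tau> (Suc i)) \<omega>) - Im (Z (\<tau> i) \<omega>)"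
  have pos: "0 \<le> \<tau> i" if "i \<le> n" for i
    using that by (induction i) (use \<tau> in \<open>auto intro: order_trans\<close>)
  let ?D = "\<lambda>x::real \<Rightarrow> real. \<lambda>i\<in>{..<n}. x (\<tau> (Suc i)) - x (\<tau> i)"
  have "?D \<in> measurable (PiM {0..} (\<lambda>_. borel)) (PiM {..<n} (\<lambda>_. borel))"
    using pos by (intro measurable_restrict borel_measurable_diff measurable_component_singleton) auto
  from indep_var_compose[OF indep_coordinates this this]
  have "indep_var (PiM {..<n} (\<lambda>_. borel)) (\<lambda>\<omega>. \<lambda>i\<in>{..<n}. ?X i \<omega>) (PiM {..<n} (\<lambda>_. borel)) (\<lambda>\<omega>. \<lambda>i\<in>{..<n}. ?Y i \<omega>)"
    using pos by (simp add: comp_def cong: restrict_cong)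
  from indep_vars_Pair[OF _ Re.indep_increments[OF \<tau>] Im.indep_increments[OF \<tau>] this]
  have "indep_vars (\<lambda>i. borel \<Otimes>\<^sub>M borel) (\<lambda>i \<omega>. (?X i \<omega>, ?Y i \<omega>)) {..<n}" by simp
  from indep_vars_compose2[OF this measurable_Complex_pair]
  show ?thesis
    by (rule iffD1[OF indep_vars_cong, rotated -1]) (auto simp: fun_eq_iff complex_eq_iff)
qed

text \<open>The right-hand side does not mention \<open>f\<close>, so comparing \<open>f\<close>
  with the identity gives equal finite-dimensional laws. An additive map sends increments to
  increments and keeps them independent, and by \<open>fG\<close> it preserves their Gaussian
  laws.\<close>

lemma path_law_fdd:
  fixes f :: "complex \<Rightarrow> complex"
  assumes fm [measurable]: "f \<in> borel_measurable borel" and fadd: "\<And>x y. f (x + y) = f x + f y"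
    and fG: "\<And>\<sigma>. 0 < \<sigma> \<Longrightarrow> distr (gauss2 \<sigma>) borel f = gauss2 \<sigma>"
    and n: "0 < n" and \<tau>: "\<tau> 0 = 0" "\<And>i. i < n \<Longrightarrow> \<tau> i < \<tau> (Suc i)" and J: "J \<subseteq> \<tau> ` {..n}" "J \<subseteq> {0..}"
    and A: "\<And>j. j \<in> J \<Longrightarrow> A j \<in> sets borel"
  shows "emeasure (distr M path_space (\<lambda>\<omega>. \<lambda>t\<in>{0..}. f (Z t \<omega>))) (prod_emb {0..} (\<lambda>_. borel) J (Pi\<^sub>E J A)) =
    emeasure (PiM {..<n} (\<lambda>i. gauss2 (sqrt (\<tau> (Suc i) - \<tau> i))))
      {x \<in> space (PiM {..<n} (\<lambda>_. borel)). \<forall>k\<in>{..n}. \<tau> k \<in> J \<longrightarrow> (\<Sum>i<k. x i) \<in> A (\<tau> k)}"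
proof -
  have f0: "f 0 = 0" using fadd[of 0 0] by simp
  have fdiff: "f (x - y) = f x - f y" for x y using fadd[of "x - y" y] by (simp add: algebra_simps)
  have finJ: "finite J" using J(1) finite_subset by blast
  have pos: "0 \<le> \<tau> i" if "i \<le> n" for i
    using that by (induction i) (use \<tau> in \<open>auto intro: order_trans[OF _ less_imp_le]\<close>)
  let ?P = "PiM {..<n} (\<lambda>_. borel) :: (nat \<Rightarrow> complex) measure"
  let ?G = "\<lambda>i. gauss2 (sqrt (\<tau> (Suc i) - \<tau> i))"
  let ?C = "{x \<in> space ?P. \<forall>k\<in>{..n}. \<tau> k \<in> J \<longrightarrow> (\<Sum>i<k. x i) \<in> A (\<tau> k)}"
  let ?\<Delta> = "\<lambda>i \<omega>. f (Z (\<tau> (Suc i)) \<omega> - Z (\<tau> i) \<omega>)"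
  let ?V = "\<lambda>\<omega>. \<lambda>i\<in>{..<n}. ?\<Delta> i \<omega>"
  let ?E = "prod_emb {0..} (\<lambda>_. borel) J (Pi\<^sub>E J A)"
  let ?Q = "\<lambda>\<omega>. \<lambda>t\<in>{0..}. f (Z t \<omega>)"
  have Qm: "?Q \<in> measurable M path_space" by (intro measurable_restrict) auto
  have E: "?E \<in> sets path_space" using A finJ J(2) by (intro sets_PiM_I) auto
  have C: "?C \<in> sets ?P"
  proof (intro sets.sets_Collect_finite_All)
    fix k assume k: "k \<in> {..n}"
    show "{x \<in> space ?P. \<tau> k \<in> J \<longrightarrow> (\<Sum>i<k. x i) \<in> A (\<tau> k)} \<in> sets ?P"
    proof (cases "\<tau> k \<in> J")
      case True
      have m: "(\<lambda>x. \<Sum>i<k. x i) \<in> borel_measurable ?P"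
        using k by (intro borel_measurable_sum measurable_component_singleton) auto
      then show ?thesis using True measurable_sets[OF m A[OF True]] by (simp add: vimage_def Int_def conj_commute)
    qed simp
  qed simp
  have ind: "indep_vars (\<lambda>_. borel) ?\<Delta> {..<n}"
    using indep_vars_compose2[OF indep_increments[of \<tau> n] fm] \<tau> by (simp add: less_imp_le)
  have dist\<Delta>: "distr M borel (?\<Delta> i) = ?G i" if "i < n" for i
  proof -
    have [measurable]: "random_variable borel (Z (\<tau> (Suc i)))" "random_variable borel (Z (\<tau> i))"
      using pos that by auto
    have "distr M borel (?\<Delta> i) = distr (distr M borel (\<lambda>\<omega>. Z (\<tau> (Suc i)) \<omega> - Z (\<tau> i) \<omega>)) borel f"
      by (subst distr_distr) (auto simp: comp_def)
    also have "\<dots> = ?G i" using pos[of i] \<tau>(2)[OF that] that by (subst distr_increment) (auto simp: fG)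
    finally show ?thesis .
  qed
  have Vm: "?V \<in> measurable M ?P"
    using ind by (intro measurable_restrict) (auto simp: indep_vars_def)
  have "distr M ?P ?V = PiM {..<n} (\<lambda>i. distr M borel (?\<Delta> i))"
    using ind n by (subst indep_vars_iff_distr_eq_PiM'[symmetric]) (auto simp: indep_vars_def)
  also have "\<dots> = PiM {..<n} ?G" using dist\<Delta> by (intro PiM_cong) auto
  finally have dV: "distr M ?P ?V = PiM {..<n} ?G" .
  have "emeasure (distr M path_space ?Q) ?E = emeasure M (?Q -` ?E \<inter> space M)"
    using Qm E by (rule emeasure_distr)
  also have "\<dots> = emeasure M (?V -` ?C \<inter> space M)"
  proof (rule emeasure_eq_AE)
    \<comment> \<open>The transformed increments telescope to
      \<open>f (Z (\<tau> k) \<omega>)\<close> only up to \<open>f (Z 0 \<omega>)\<close>, which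
      vanishes almost surely.\<close>
    show "AE \<omega> in M. \<omega> \<in> ?Q -` ?E \<inter> space M \<longleftrightarrow> \<omega> \<in> ?V -` ?C \<inter> space M"
      using starts_at_0 AE_space
    proof eventually_elim
      case (elim \<omega>)
      have sum: "(\<Sum>i<k. ?V \<omega> i) = f (Z (\<tau> k) \<omega>)" if "k \<le> n" for k
      proof -
        have "(\<Sum>i<k. ?V \<omega> i) = (\<Sum>i<k. f (Z (\<tau> (Suc i)) \<omega>) - f (Z (\<tau> i) \<omega>))"
          using that by (intro sum.cong) (auto simp: fdiff)
        also have "\<dots> = f (Z (\<tau> k) \<omega>) - f (Z (\<tau> 0) \<omega>)" by (rule sum_lessThan_telescope)
        finally show ?thesis using \<tau>(1) elim f0 by simp
      qed
      have "?Q \<omega> \<in> ?E \<longleftrightarrow> (\<forall>j\<in>J. f (Z j \<omega>) \<in> A j)"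
        using J(2) by (auto simp: prod_emb_def PiE_iff subset_eq)
      also have "\<dots> \<longleftrightarrow> (\<forall>k\<in>{..n}. \<tau> k \<in> J \<longrightarrow> f (Z (\<tau> k) \<omega>) \<in> A (\<tau> k))"
        using J(1) by auto
      also have "\<dots> \<longleftrightarrow> ?V \<omega> \<in> ?C"
        using measurable_space[OF Vm elim(2)] sum by auto
      finally show ?case using elim by auto
    qed
  qed (use measurable_sets[OF Qm E] measurable_sets[OF Vm C] in auto)
  also have "\<dots> = emeasure (distr M ?P ?V) ?C" using Vm C by (rule emeasure_distr[symmetric])
  also have "\<dots> = emeasure (PiM {..<n} ?G) ?C" by (simp only: dV)
  finally show ?thesis .
qed

lemma path_law_invariant:
  fixes f :: "complex \<Rightarrow> complex"
  assumes fm [measurable]: "f \<in> borel_measurable borel" and fadd: "\<And>x y. f (x + y) = f x + f y"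
    and fG: "\<And>\<sigma>. 0 < \<sigma> \<Longrightarrow> distr (gauss2 \<sigma>) borel f = gauss2 \<sigma>"
  shows "distr M path_space (\<lambda>\<omega>. \<lambda>t\<in>{0..}. f (Z t \<omega>)) = distr M path_space (\<lambda>\<omega>. \<lambda>t\<in>{0..}. Z t \<omega>)"
proof (rule measure_eqI_PiM_infinite)
  fix A :: "real \<Rightarrow> complex set" and J :: "real set"
  assume J: "finite J" "J \<subseteq> {0..}" and A: "\<And>j. j \<in> J \<Longrightarrow> A j \<in> sets borel"
  obtain n \<tau> where \<tau>: "0 < n" "\<tau> 0 = 0" "\<And>i. i < n \<Longrightarrow> \<tau> i < \<tau> (Suc i)" "J \<subseteq> \<tau> ` {..n}"
    using finite_times_grid[OF J] by blast
  have id: "distr (gauss2 \<sigma>) borel (\<lambda>z. z) = gauss2 \<sigma>" for \<sigma> by (rule distr_id2) simp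
  show "emeasure (distr M path_space (\<lambda>\<omega>. \<lambda>t\<in>{0..}. f (Z t \<omega>))) (prod_emb {0..} (\<lambda>_. borel) J (Pi\<^sub>E J A)) =
     emeasure (distr M path_space (\<lambda>\<omega>. \<lambda>t\<in>{0..}. Z t \<omega>)) (prod_emb {0..} (\<lambda>_. borel) J (Pi\<^sub>E J A))"
    using path_law_fdd[of f, OF fm fadd fG \<tau> J(2), where A=A] path_law_fdd[of "\<lambda>z. z", OF _ _ id \<tau> J(2), where A=A] A
    by simp
next
  have "(\<lambda>\<omega>. \<lambda>t\<in>{0..}. f (Z t \<omega>)) \<in> measurable M path_space" by (intro measurable_restrict) auto
  then show "finite_measure (distr M path_space (\<lambda>\<omega>. \<lambda>t\<in>{0..}. f (Z t \<omega>)))" by (rule finite_measure_distr)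
qed simp_all

text \<open>The paths \<open>e * Z\<close> and \<open>e * cnj Z\<close> are mirror images of each
  other in the line through 0 and \<open>e\<close>. Using this pair instead of \<open>Z\<close> and
  its reflection moves the ray to the positive real axis.\<close>

lemma path_law_isometry:
  assumes "cmod w = 1"
  shows "distr M path_space (\<lambda>\<omega>. \<lambda>t\<in>{0..}. w * Z t \<omega>) = distr M path_space (\<lambda>\<omega>. \<lambda>t\<in>{0..}. Z t \<omega>)"
    and "distr M path_space (\<lambda>\<omega>. \<lambda>t\<in>{0..}. w * cnj (Z t \<omega>)) = distr M path_space (\<lambda>\<omega>. \<lambda>t\<in>{0..}. Z t \<omega>)"
proof -
  have cm [measurable]: "cnj \<in> borel_measurable borel" by (intro borel_measurable_continuous_onI continuous_intros)
  have "distr (gauss2 \<sigma>) borel (\<lambda>z. w * cnj z) = gauss2 \<sigma>" if "0 < \<sigma>" for \<sigma>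
  proof -
    have "distr (gauss2 \<sigma>) borel (\<lambda>z. w * cnj z) = distr (distr (gauss2 \<sigma>) borel cnj) borel ((*) w)"
      by (subst distr_distr) (auto simp: comp_def)
    then show ?thesis by (simp add: distr_gauss2_cnj distr_gauss2_rotate that assms)
  qed
  then show "distr M path_space (\<lambda>\<omega>. \<lambda>t\<in>{0..}. w * cnj (Z t \<omega>)) = distr M path_space (\<lambda>\<omega>. \<lambda>t\<in>{0..}. Z t \<omega>)"
    by (intro path_law_invariant) (auto simp: algebra_simps)
  show "distr M path_space (\<lambda>\<omega>. \<lambda>t\<in>{0..}. w * Z t \<omega>) = distr M path_space (\<lambda>\<omega>. \<lambda>t\<in>{0..}. Z t \<omega>)"
    using distr_gauss2_rotate[OF _ assms] by (intro path_law_invariant) (auto simp: distrib_left)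
qed

end

subsection \<open>Hitting a closed set\<close>

text \<open>Events of \<open>path_space\<close> depend on countably many times only, so meeting
  \<open>K\<close> has to be expressed through dyadic times. These may miss the moment of contact;
  hence the condition of coming arbitrarily close.\<close>

definition hits :: "complex set \<Rightarrow> real \<Rightarrow> (real \<Rightarrow> complex) \<Rightarrow> bool" where
  "hits K T z \<longleftrightarrow> (\<forall>n. \<exists>q\<in>dyadic_times 0 T. infdist (z q) K < 1 / real (Suc n))"

lemma hits_measurable:
  assumes "0 \<le> T"
  shows "{z \<in> space path_space. hits K T z} \<in> sets path_space"
proof -
  have "(\<lambda>z. infdist (z q) K) \<in> borel_measurable path_space" if "q \<in> dyadic_times 0 T" for q
  proof -
    have "(\<lambda>x. infdist x K) \<in> borel_measurable borel"
      by (intro borel_measurable_continuous_onI continuous_intros)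
    moreover have "(\<lambda>z. z q) \<in> measurable path_space borel"
      using that dyadic_times_subset[OF assms] by (intro measurable_component_singleton) auto
    ultimately show ?thesis by (rule measurable_compose[rotated])
  qed
  then show ?thesis
    unfolding hits_def
    by (intro sets.sets_Collect_countable_All sets.sets_Collect_countable_Ex' borel_measurable_less countable_dyadic_times) auto
qed

text \<open>The distance to \<open>K\<close> attains its minimum along the path on the compact
  interval, and under \<open>hits\<close> this minimum is below every \<open>1 / (n + 1)\<close>.
  Conversely, a positive lower bound for the distance at the dyadic times would extend to all times
  by continuity.\<close>

lemma hits_iff:
  assumes K: "closed K" "K \<noteq> {}" and T: "0 \<le> T" and z: "continuous_on {0..T} z"
  shows "hits K T z \<longleftrightarrow> (\<exists>u\<in>{0..T}. z u \<in> K)"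
proof
  have cont: "continuous_on {0..T} (\<lambda>u. infdist (z u) K)" using z by (intro continuous_intros)
  assume h: "hits K T z"
  obtain u where u: "u \<in> {0..T}" "\<And>v. v \<in> {0..T} \<Longrightarrow> infdist (z u) K \<le> infdist (z v) K"
    using continuous_attains_inf[OF compact_Icc _ cont] T by auto
  have "infdist (z u) K < 1 / real (Suc n)" for n
  proof -
    obtain q where "q \<in> dyadic_times 0 T" "infdist (z q) K < 1 / real (Suc n)" using h unfolding hits_def by blast
    then show ?thesis using u(2)[of q] dyadic_times_subset[OF T] by auto
  qed
  then have "\<not> 0 < infdist (z u) K" using nat_approx_posE not_less_iff_gr_or_eq by metis
  then have "infdist (z u) K = 0" using infdist_nonneg[of "z u" K] by linarith
  then show "\<exists>u\<in>{0..T}. z u \<in> K" using u(1) in_closed_iff_infdist_zero[OF K] by auto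
next
  have cont: "continuous_on {0..T} (\<lambda>u. - infdist (z u) K)" using z by (intro continuous_intros)
  assume "\<exists>u\<in>{0..T}. z u \<in> K"
  then obtain u where u: "u \<in> {0..T}" "infdist (z u) K = 0" by auto
  show "hits K T z" unfolding hits_def
  proof (rule ccontr)
    assume "\<not> (\<forall>n. \<exists>q\<in>dyadic_times 0 T. infdist (z q) K < 1 / real (Suc n))"
    then obtain n where "\<forall>q\<in>dyadic_times 0 T. \<not> infdist (z q) K < 1 / real (Suc n)" by blast
    then have "\<And>q. q \<in> dyadic_times 0 T \<Longrightarrow> - infdist (z q) K \<le> - (1 / real (Suc n))"
      by (meson neg_le_iff_le not_less)
    from dyadic_times_le_extend[OF T cont this u(1)] u(2) show False by simp
  qed
qed

text \<open>Links \<open>exit_prob\<close>, which measures a set in the completion, to honest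
  events: \<open>S\<close> differs from \<open>E\<close> only inside a null set, all of whose
  subsets are measurable in the completion.\<close>

lemma (in prob_space) measure_completion_AE:
  assumes E: "E \<in> events" and S: "S \<subseteq> space M" and eq: "AE \<omega> in M. \<omega> \<in> S \<longleftrightarrow> \<omega> \<in> E"
  shows "measure (completion M) S = prob E"
proof -
  have eq': "AE \<omega> in completion M. \<omega> \<in> E \<longleftrightarrow> \<omega> \<in> S"
    by (rule AE_completion) (use eq in auto)
  obtain N where N: "N \<in> null_sets M" "{\<omega> \<in> space M. \<not> (\<omega> \<in> S \<longleftrightarrow> \<omega> \<in> E)} \<subseteq> N"
    using eq unfolding eventually_ae_filter by auto
  have "S = (E - N) \<union> (S \<inter> N)" 
    using N(2) S sets.sets_into_space[OF E] by blast
  moreover have "S \<inter> N \<in> sets (completion M)"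
    using N(1) by (intro null_setsD2) (auto simp: null_sets_completion_iff2)
  moreover have "E - N \<in> sets (completion M)" using E N(1) by auto
  ultimately have Sm: "S \<in> sets (completion M)" by (metis sets.Un)
  have "emeasure (completion M) S = emeasure (completion M) E"
    by (rule emeasure_eq_AE) (use eq' Sm E in \<open>auto\<close>)
  then show ?thesis using E by (simp add: measure_def)
qed

context planar_brownian_motion
begin

definition path :: "'a \<Rightarrow> real \<Rightarrow> complex" where
  "path \<omega> = (\<lambda>t\<in>{0..}. Z t \<omega>)"

lemma path_measurable: "path \<in> measurable M path_space"
  unfolding path_def by (intro measurable_restrict) auto

lemma hits_restrict: "0 \<le> T \<Longrightarrow> hits K T (\<lambda>t\<in>{0..}. z t) \<longleftrightarrow> hits K T z"
  using dyadic_times_subset[of 0 T] unfolding hits_def by (intro all_cong1 bex_cong refl) auto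

lemma hits_event:
  assumes "0 \<le> T" 
  shows "{\<omega> \<in> space M. hits K T (\<lambda>t. Z t \<omega>)} \<in> events"
proof -
  have "{\<omega> \<in> space M. hits K T (\<lambda>t. Z t \<omega>)} = path -` {z \<in> space path_space. hits K T z} \<inter> space M"
    using measurable_space[OF path_measurable] hits_restrict[OF assms] by (auto simp: path_def)
  then show ?thesis using measurable_sets[OF path_measurable hits_measurable[OF assms]] by simp
qed

lemma prob_hits_isometry:
  assumes w: "cmod w = 1" and T: "0 \<le> T"
  shows "{\<omega> \<in> space M. hits K T (\<lambda>t. w * Z t \<omega>)} \<in> events"
    "prob {\<omega> \<in> space M. hits K T (\<lambda>t. w * Z t \<omega>)} = prob {\<omega> \<in> space M. hits K T (\<lambda>t. Z t \<omega>)}"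
    "{\<omega> \<in> space M. hits K T (\<lambda>t. w * cnj (Z t \<omega>))} \<in> events"
    "prob {\<omega> \<in> space M. hits K T (\<lambda>t. w * cnj (Z t \<omega>))} = prob {\<omega> \<in> space M. hits K T (\<lambda>t. Z t \<omega>)}"
proof -
  let ?H = "{z \<in> space path_space. hits K T z}"
  have gen: "{\<omega> \<in> space M. hits K T (\<lambda>t. Y t \<omega>)} \<in> events \<and>
      prob {\<omega> \<in> space M. hits K T (\<lambda>t. Y t \<omega>)} = prob {\<omega> \<in> space M. hits K T (\<lambda>t. Z t \<omega>)}"
    if Ym: "(\<lambda>\<omega>. \<lambda>t\<in>{0..}. Y t \<omega>) \<in> measurable M path_space"
      and law: "distr M path_space (\<lambda>\<omega>. \<lambda>t\<in>{0..}. Y t \<omega>) = distr M path_space path" for Y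
  proof -
    have eq: "{\<omega> \<in> space M. hits K T (\<lambda>t. Y t \<omega>)} = (\<lambda>\<omega>. \<lambda>t\<in>{0..}. Y t \<omega>) -` ?H \<inter> space M"
      using measurable_space[OF Ym] hits_restrict[OF T] by auto
    have eqZ: "{\<omega> \<in> space M. hits K T (\<lambda>t. Z t \<omega>)} = path -` ?H \<inter> space M"
      using measurable_space[OF path_measurable] hits_restrict[OF T] by (auto simp: path_def)
    show ?thesis
      using measurable_sets[OF Ym hits_measurable[OF T]] measure_distr[OF Ym hits_measurable[OF T]]
        measure_distr[OF path_measurable hits_measurable[OF T]] law eq eqZ by simp
  qed
  have [measurable]: "cnj \<in> borel_measurable borel" by (intro borel_measurable_continuous_onI continuous_intros)
  have m: "(\<lambda>\<omega>. \<lambda>t\<in>{0..}. w * Z t \<omega>) \<in> measurable M path_space"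
    "(\<lambda>\<omega>. \<lambda>t\<in>{0..}. w * cnj (Z t \<omega>)) \<in> measurable M path_space"
    by (intro measurable_restrict; simp)+
  show "{\<omega> \<in> space M. hits K T (\<lambda>t. w * Z t \<omega>)} \<in> events"
    "prob {\<omega> \<in> space M. hits K T (\<lambda>t. w * Z t \<omega>)} = prob {\<omega> \<in> space M. hits K T (\<lambda>t. Z t \<omega>)}"
    using gen[of "\<lambda>t \<omega>. w * Z t \<omega>", OF m(1)] path_law_isometry(1)[OF w] by (auto simp: path_def[abs_def])
  show "{\<omega> \<in> space M. hits K T (\<lambda>t. w * cnj (Z t \<omega>))} \<in> events"
    "prob {\<omega> \<in> space M. hits K T (\<lambda>t. w * cnj (Z t \<omega>))} = prob {\<omega> \<in> space M. hits K T (\<lambda>t. Z t \<omega>)}"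
    using gen[of "\<lambda>t \<omega>. w * cnj (Z t \<omega>)", OF m(2)] path_law_isometry(2)[OF w] by (auto simp: path_def[abs_def])
qed

text \<open>\<open>hits\<close> deals with closed intervals, whereas exit before \<open>t\<close>
  concerns times in the half-open interval from 0 to \<open>t\<close>; the event is therefore a
  countable union over the times \<open>?T m\<close>, which increase to \<open>t\<close>.\<close>

lemma exit_prob_event:
  assumes V: "open V" "V \<noteq> UNIV" "0 \<in> V" and t: "0 < t"
  obtains E where "E \<in> events" "exit_prob M Z V t = prob E"
    "AE \<omega> in M. \<omega> \<in> E \<longleftrightarrow> (\<exists>u\<in>{0..<t}. Z u \<omega> \<notin> V)"
proof -
  let ?T = "\<lambda>m::nat. t * (1 - 1 / real (m + 2))"
  have T0: "0 \<le> ?T m" "?T m < t" for m using t by (auto simp: field_simps)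
  let ?E = "{\<omega> \<in> space M. \<exists>m. hits (- V) (?T m) (\<lambda>t. Z t \<omega>)}"
  have "?E = (\<Union>m. {\<omega> \<in> space M. hits (- V) (?T m) (\<lambda>t. Z t \<omega>)})" by auto
  also have "\<dots> \<in> events" using hits_event[OF T0(1)] by (intro sets.countable_UN) auto
  finally have E: "?E \<in> events" .
  have AE1: "AE \<omega> in M. \<omega> \<in> ?E \<longleftrightarrow> (\<exists>u\<in>{0..<t}. Z u \<omega> \<notin> V)"
    using continuous_paths AE_space
  proof eventually_elim
    case (elim \<omega>)
    have h: "hits (- V) (?T m) (\<lambda>t. Z t \<omega>) \<longleftrightarrow> (\<exists>u\<in>{0..?T m}. Z u \<omega> \<in> - V)" for m
      using V T0(1) by (intro hits_iff continuous_on_subset[OF elim(1)]) auto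
    have "(\<exists>u\<in>{0..<t}. Z u \<omega> \<notin> V) \<longleftrightarrow> (\<exists>m. \<exists>u\<in>{0..?T m}. Z u \<omega> \<in> - V)"
    proof
      assume "\<exists>u\<in>{0..<t}. Z u \<omega> \<notin> V"
      then obtain u where u: "0 \<le> u" "u < t" "Z u \<omega> \<notin> V" by auto
      have "0 < 1 - u / t" using u t by (simp add: field_simps)
      then obtain m where m: "1 / real (Suc m) < 1 - u / t" by (rule nat_approx_posE)
      have "1 / real (m + 2) \<le> 1 / real (Suc m)" by (intro divide_left_mono) auto
      then have "u / t \<le> 1 - 1 / real (m + 2)" using m by linarith
      then have "u \<le> ?T m" using t by (simp add: pos_divide_le_eq mult.commute)
      then show "\<exists>m. \<exists>u\<in>{0..?T m}. Z u \<omega> \<in> - V" using u by (intro exI[of _ m] bexI[of _ u]) auto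
    next
      assume "\<exists>m. \<exists>u\<in>{0..?T m}. Z u \<omega> \<in> - V"
      then obtain m u where "0 \<le> u" "u \<le> ?T m" "Z u \<omega> \<notin> V" by auto
      then show "\<exists>u\<in>{0..<t}. Z u \<omega> \<notin> V" using T0(2)[of m] by (intro bexI[of _ u]) auto
    qed
    then show ?case using elim h by auto
  qed
  have "exit_prob M Z V t = prob ?E"
    unfolding exit_prob_def
  proof (rule measure_completion_AE[OF E])
    show "AE \<omega> in M. \<omega> \<in> {\<omega> \<in> space M. exit_time Z V \<omega> < ereal t} \<longleftrightarrow> \<omega> \<in> ?E"
      using AE1 starts_at_0 AE_space
    proof eventually_elim
      case (elim \<omega>)
      \<comment> \<open>An infimum lies strictly below \<open>t\<close> iff some element does, so it
        need not be attained. The definition looks at positive times only, and adding time 0 changes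
        nothing, as \<open>Z 0 \<omega> = 0\<close> lies in \<open>V\<close>.\<close>
      have "exit_time Z V \<omega> < ereal t \<longleftrightarrow> (\<exists>u. 0 < u \<and> Z u \<omega> \<notin> V \<and> u < t)"
        unfolding exit_time_def Inf_less_iff by auto
      also have "\<dots> \<longleftrightarrow> (\<exists>u\<in>{0..<t}. Z u \<omega> \<notin> V)"
        using elim(2) V(3) by (metis atLeastLessThan_iff less_eq_real_def)
      finally show ?case using elim by auto
    qed
  qed auto
  then show ?thesis using E AE1 that by blast
qed

lemma exit_prob_ge_hits:
  assumes V: "open V" "V \<noteq> UNIV" "0 \<in> V" and T: "0 \<le> T" "T < t"
  shows "prob {\<omega> \<in> space M. hits (- V) T (\<lambda>t. Z t \<omega>)} \<le> exit_prob M Z V t"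
proof -
  have t: "0 < t" using T by simp
  obtain E where E: "E \<in> events" "exit_prob M Z V t = prob E"
    "AE \<omega> in M. \<omega> \<in> E \<longleftrightarrow> (\<exists>u\<in>{0..<t}. Z u \<omega> \<notin> V)"
    using exit_prob_event[OF V t] by blast
  show ?thesis unfolding E(2)
  proof (rule finite_measure_mono_AE[OF _ E(1)])
    show "AE \<omega> in M. \<omega> \<in> {\<omega> \<in> space M. hits (- V) T (\<lambda>t. Z t \<omega>)} \<longrightarrow> \<omega> \<in> E"
      using continuous_paths E(3)
    proof eventually_elim
      case (elim \<omega>)
      have "hits (- V) T (\<lambda>t. Z t \<omega>) \<longleftrightarrow> (\<exists>u\<in>{0..T}. Z u \<omega> \<in> - V)"
        using V T by (intro hits_iff continuous_on_subset[OF elim(1)]) auto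
      then show ?case using elim(2) T(2) by force
    qed
  qed
qed

text \<open>On \<open>R\<close> one of the paths \<open>e * Z\<close> and \<open>e * cnj Z\<close>
  leaves \<open>V\<close> by time \<open>T\<close>. Each has the law of \<open>Z\<close>, so the
  union bound gives the factor 2. \<open>R\<close> may be any measurable part of the event that the
  ray is reached.\<close>

lemma prob_ray_le_exit_prob:
  assumes V: "open V" "simply_connected V" "0 \<in> V" 
    and d: "0 < d" and e: "cmod e = 1" "e * of_real d \<notin> V" and T: "0 \<le> T" "T < t"
    and R: "R \<in> events" "AE \<omega> in M. \<omega> \<in> R \<longrightarrow> (\<exists>u\<in>{0..T}. Im (Z u \<omega>) = 0 \<and> d \<le> Re (Z u \<omega>))"
  shows "prob R \<le> 2 * exit_prob M Z V t"
proof -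
  have V': "V \<noteq> UNIV" using e by auto
  let ?H = "\<lambda>Y. {\<omega> \<in> space M. hits (- V) T (\<lambda>t. Y t \<omega>)}"
  note iso = prob_hits_isometry[OF e(1) T(1), of "- V"]
  have "prob R \<le> prob (?H (\<lambda>t \<omega>. e * Z t \<omega>) \<union> ?H (\<lambda>t \<omega>. e * cnj (Z t \<omega>)))"
  proof (rule finite_measure_mono_AE)
    show "AE \<omega> in M. \<omega> \<in> R \<longrightarrow> \<omega> \<in> ?H (\<lambda>t \<omega>. e * Z t \<omega>) \<union> ?H (\<lambda>t \<omega>. e * cnj (Z t \<omega>))"
      using R(2) starts_at_0 continuous_paths AE_space
    proof eventually_elim
      case (elim \<omega>)
      show ?case
      proof
        assume "\<omega> \<in> R"
        then obtain u where u: "0 \<le> u" "u \<le> T" "Im (Z u \<omega>) = 0" "d \<le> Re (Z u \<omega>)" using elim(1) by auto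
        have c: "continuous_on {0..v} (\<lambda>t. Z t \<omega>)" for v using elim(3) by (rule continuous_on_subset) auto
        have "\<exists>v\<in>{0..u}. e * Z v \<omega> \<notin> V \<or> e * cnj (Z v \<omega>) \<notin> V"
          using symmetric_paths_leave[OF V(1,2) d e u(1) c elim(2) u(3,4)] .
        moreover have "hits (- V) T (\<lambda>t. e * Z t \<omega>) \<longleftrightarrow> (\<exists>v\<in>{0..T}. e * Z v \<omega> \<in> - V)"
          using V V' T c by (intro hits_iff continuous_intros) auto
        moreover have "hits (- V) T (\<lambda>t. e * cnj (Z t \<omega>)) \<longleftrightarrow> (\<exists>v\<in>{0..T}. e * cnj (Z v \<omega>) \<in> - V)"
          using V V' T c by (intro hits_iff continuous_intros) auto
        ultimately show "\<omega> \<in> ?H (\<lambda>t \<omega>. e * Z t \<omega>) \<union> ?H (\<lambda>t \<omega>. e * cnj (Z t \<omega>))"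
          using u elim(4) by force
      qed
    qed
  qed (use iso in auto)
  also have "\<dots> \<le> prob (?H (\<lambda>t \<omega>. e * Z t \<omega>)) + prob (?H (\<lambda>t \<omega>. e * cnj (Z t \<omega>)))"
    using iso by (intro measure_Un_le) auto
  also have "\<dots> = 2 * prob (?H Z)" unfolding iso(2,4) by simp
  also have "\<dots> \<le> 2 * exit_prob M Z V t"
    using exit_prob_ge_hits[OF V(1) V' V(3) T] by simp
  finally show ?thesis .
qed

end

subsection \<open>Gaussian tails\<close>

abbreviation std_normal :: "real measure" where
  "std_normal \<equiv> density lborel std_normal_density"

interpretation std_normal: prob_space std_normal
  by (rule prob_space_normal_density) simp

lemma normal_tail_antimono: "x \<le> y \<Longrightarrow> normal_tail y \<le> normal_tail x"
  unfolding normal_tail_def by (intro std_normal.finite_measure_mono) auto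

lemma normal_tail_strict_antimono:
  assumes "x < y" shows "normal_tail y < normal_tail x"
proof -
  have "emeasure std_normal {x<..<y} \<noteq> 0"
  proof
    assume "emeasure std_normal {x<..<y} = 0"
    then have "{x<..<y} \<in> null_sets std_normal" by auto
    then have "AE u in lborel. u \<in> {x<..<y} \<longrightarrow> ennreal (std_normal_density u) = 0"
      by (subst (asm) null_sets_density_iff) auto
    then have "AE u in lborel. u \<notin> {x<..<y}"
      by eventually_elim (metis ennreal_eq_0_iff normal_density_pos not_le zero_less_one)
    then have "{x<..<y} \<in> null_sets lborel" by (subst AE_iff_null_sets) auto
    then show False using assms by (auto simp: null_sets_def)
  qed
  then have "0 < measure std_normal {x<..<y}"
    by (simp add: std_normal.emeasure_eq_measure zero_less_measure_iff)
  moreover have "normal_tail x = measure std_normal ({x<..<y} \<union> {y..})"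
    unfolding normal_tail_def using assms by (intro arg_cong2[where f=measure]) auto
  moreover have "\<dots> = measure std_normal {x<..<y} + measure std_normal {y..}"
    by (intro std_normal.finite_measure_Union) auto
  moreover have "normal_tail y \<le> measure std_normal {y..}"
    unfolding normal_tail_def by (intro std_normal.finite_measure_mono) auto
  ultimately show ?thesis by linarith
qed

lemma normal_tail_pos: "0 < normal_tail x"
  using normal_tail_strict_antimono[of x "x + 1"] measure_nonneg[of std_normal "{x + 1<..}"]
  unfolding normal_tail_def by linarith

text \<open>The substitution \<open>x = k * u\<close> with \<open>k = b / a\<close> carries the
  half-line above \<open>a * y\<close> to the one above \<open>b * y\<close>. There the densities at
  \<open>k * u\<close> and \<open>u\<close> have quotient
  \<open>exp (- ((k\<^sup>2 - 1) * u\<^sup>2 / 2))\<close>, which is at most its value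
  \<open>E\<close> at \<open>u = a * y\<close>. Two tails are compared directly, without asymptotics
  of either.\<close>

lemma normal_tail_scale:
  assumes ab: "0 < a" "a < b" and y: "0 \<le> y"
  shows "normal_tail (b * y) \<le> b / a * exp (- ((b\<^sup>2 - a\<^sup>2) * y\<^sup>2 / 2)) * normal_tail (a * y)"
proof -
  define k where "k = b / a"
  define E where "E = exp (- ((b\<^sup>2 - a\<^sup>2) * y\<^sup>2 / 2))"
  have k: "1 < k" "b = k * a" using ab by (auto simp: k_def)
  have "emeasure std_normal {b * y<..} = (\<integral>\<^sup>+x. ennreal (std_normal_density x) * indicator {b * y<..} x \<partial>lborel)"
    by (simp add: emeasure_density)
  also have "\<dots> = ennreal k * (\<integral>\<^sup>+u. ennreal (std_normal_density (k * u)) * indicator {b * y<..} (k * u) \<partial>lborel)"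
    using k by (subst nn_integral_real_affine[where c=k and t=0]) auto
  also have "\<dots> \<le> ennreal k * (\<integral>\<^sup>+u. ennreal E * (ennreal (std_normal_density u) * indicator {a * y<..} u) \<partial>lborel)"
  proof (intro mult_left_mono nn_integral_mono)
    fix u :: real
    show "ennreal (std_normal_density (k * u)) * indicator {b * y<..} (k * u) \<le>
      ennreal E * (ennreal (std_normal_density u) * indicator {a * y<..} u)"
    proof (cases "a * y < u")
      case True
      have "(a * y)\<^sup>2 \<le> u\<^sup>2" using True ab y by (intro power_mono) auto
      then have "(k\<^sup>2 - 1) * (a * y)\<^sup>2 \<le> (k\<^sup>2 - 1) * u\<^sup>2"
        using k(1) by (intro mult_left_mono) (auto simp: power2_eq_square intro: less_imp_le less_1_mult)
      then have "(b\<^sup>2 - a\<^sup>2) * y\<^sup>2 \<le> (k * u)\<^sup>2 - u\<^sup>2"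
        unfolding k(2) by (simp add: power_mult_distrib algebra_simps)
      then have "exp (- (k * u)\<^sup>2 / 2) \<le> exp (- ((b\<^sup>2 - a\<^sup>2) * y\<^sup>2 / 2) + - u\<^sup>2 / 2)"
        by simp
      then have "std_normal_density (k * u) \<le> E * std_normal_density u"
        unfolding exp_add E_def by (simp add: std_normal_density_def divide_right_mono)
      then have "ennreal (std_normal_density (k * u)) \<le> ennreal E * ennreal (std_normal_density u)"
        by (simp add: ennreal_mult'[symmetric] E_def ennreal_leI)
      then show ?thesis using True by (auto split: split_indicator)
    next
      case False
      then show ?thesis using k by (auto split: split_indicator)
    qed
  qed simp
  also have "\<dots> = ennreal (k * E) * emeasure std_normal {a * y<..}"
    using k by (subst nn_integral_cmult) (auto simp: emeasure_density ennreal_mult' mult.assoc)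
  finally have "ennreal (normal_tail (b * y)) \<le> ennreal (k * E * normal_tail (a * y))"
    using k by (simp add: std_normal.emeasure_eq_measure normal_tail_def ennreal_mult' E_def)
  then have "normal_tail (b * y) \<le> k * E * normal_tail (a * y)"
    using k normal_tail_pos[of "a * y"] by (subst (asm) ennreal_le_iff) (auto simp: E_def)
  then show ?thesis by (simp add: k_def E_def)
qed

lemma normal_tail_ratio_at_top:
  assumes ab: "0 < a" "a < b"
  shows "filterlim (\<lambda>t. normal_tail (a / sqrt t) / normal_tail (b / sqrt t)) at_top (at_right 0)"
proof (rule filterlim_at_top_mono)
  let ?c = "(b\<^sup>2 - a\<^sup>2) / 2"
  have c: "0 < ?c" using ab by (simp add: power_strict_mono)
  have "filterlim (\<lambda>t. ?c * inverse t) at_top (at_right 0)"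
    using c by (intro filterlim_tendsto_pos_mult_at_top[OF tendsto_const] filterlim_inverse_at_top_right)
  then have "filterlim (\<lambda>t. exp (?c * inverse t)) at_top (at_right 0)"
    by (rule filterlim_compose[OF exp_at_top])
  then show "filterlim (\<lambda>t. (a / b) * exp (?c * inverse t)) at_top (at_right 0)"
    using ab by (intro filterlim_tendsto_pos_mult_at_top[OF tendsto_const]) auto
  show "\<forall>\<^sub>F t in at_right 0. (a / b) * exp (?c * inverse t) \<le> normal_tail (a / sqrt t) / normal_tail (b / sqrt t)"
    using eventually_at_right_less[of 0]
  proof eventually_elim
    case (elim t)
    let ?y = "1 / sqrt t"
    have y: "0 \<le> ?y" "?y\<^sup>2 = inverse t" using elim by (auto simp: power_divide inverse_eq_divide)
    have "(a / b) * exp (?c * inverse t) * normal_tail (b * ?y) \<le>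
       (a / b) * exp (?c * inverse t) * (b / a * exp (- (?c * inverse t)) * normal_tail (a * ?y))"
      using normal_tail_scale[OF ab y(1)] ab unfolding y(2) by (intro mult_left_mono) auto
    also have "\<dots> = normal_tail (a * ?y)" using ab by (simp add: exp_minus field_simps)
    finally show ?case using normal_tail_pos[of "b / sqrt t"] by (simp add: pos_le_divide_eq)
  qed
qed

text \<open>It suffices that the first increment lies between 0 and \<open>?h\<close> and that the
  second, independent one is below \<open>- ?h\<close>. As \<open>?h\<close> is the standard
  deviation of the second increment, its factor is \<open>normal_tail 1\<close>, and the whole bound
  depends only on the ratio of \<open>T - s\<close> to \<open>s\<close>.\<close>

lemma (in standard_brownian_motion) prob_sign_change_ge:
  assumes sT: "0 < s" "s < T"
  shows "(normal_tail 0 - normal_tail (sqrt (T - s) / sqrt s)) * normal_tail 1 \<le>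
    prob {\<omega> \<in> space M. 0 < B s \<omega> - B 0 \<omega> \<and> B T \<omega> < B 0 \<omega>}"
proof -
  interpret m: standard_brownian_motion M "\<lambda>t \<omega>. - B t \<omega>" by (rule uminus)
  let ?h = "sqrt (T - s)"
  define \<tau> :: "nat \<Rightarrow> real" where "\<tau> i = (if i = 0 then 0 else if i = 1 then s else T)" for i
  have [measurable]: "random_variable borel (B 0)" "random_variable borel (B s)" "random_variable borel (B T)"
    using random_variable_B sT by auto
  have ind: "indep_vars (\<lambda>_. borel) (\<lambda>i \<omega>. B (\<tau> (Suc i)) \<omega> - B (\<tau> i) \<omega>) {..<2}"
    using sT by (intro indep_increments) (auto simp: \<tau>_def)
  let ?A = "\<lambda>i::nat. if i = 0 then {0<..?h} else {..< - ?h}"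
  let ?E0 = "{\<omega> \<in> space M. 0 < B s \<omega> - B 0 \<omega> \<and> B s \<omega> - B 0 \<omega> \<le> ?h}"
  let ?E1 = "{\<omega> \<in> space M. B T \<omega> - B s \<omega> < - ?h}"
  define G where "G i = (\<lambda>\<omega>. B (\<tau> (Suc i)) \<omega> - B (\<tau> i) \<omega>) -` ?A i \<inter> space M" for i
  have "prob (\<Inter>i\<in>{..<2}. G i) = (\<Prod>i\<in>{..<2}. prob (G i))"
    unfolding G_def by (rule indep_varsD[OF ind]) (auto simp: lessThan_empty_iff)
  moreover have "G 0 = ?E0" "G 1 = ?E1" by (auto simp: G_def \<tau>_def)
  moreover have "{..<2} = {0, 1::nat}" by auto
  ultimately have "prob (?E0 \<inter> ?E1) = prob ?E0 * prob ?E1" by simp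
  moreover have "prob ?E1 = normal_tail 1"
  proof -
    have "?E1 = {\<omega> \<in> space M. ?h < - B T \<omega> - - B s \<omega>}" by auto
    then show ?thesis using m.prob_increment_greater[of s T ?h] sT by simp
  qed
  moreover have "prob ?E0 = normal_tail 0 - normal_tail (?h / sqrt s)"
  proof -
    have "?E0 = {\<omega> \<in> space M. 0 < B s \<omega> - B 0 \<omega>} - {\<omega> \<in> space M. ?h < B s \<omega> - B 0 \<omega>}" by auto
    also have "prob \<dots> = prob {\<omega> \<in> space M. 0 < B s \<omega> - B 0 \<omega>} - prob {\<omega> \<in> space M. ?h < B s \<omega> - B 0 \<omega>}"
    proof (rule finite_measure_Diff)
      show "{\<omega> \<in> space M. ?h < B s \<omega> - B 0 \<omega>} \<subseteq> {\<omega> \<in> space M. 0 < B s \<omega> - B 0 \<omega>}"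
      proof safe
        fix \<omega> assume "?h < B s \<omega> - B 0 \<omega>"
        moreover have "0 \<le> ?h" using sT by simp
        ultimately show "0 < B s \<omega> - B 0 \<omega>" by linarith
      qed
    qed measurable
    also have "prob {\<omega> \<in> space M. 0 < B s \<omega> - B 0 \<omega>} = normal_tail 0"
      using prob_increment_greater[of 0 s 0] sT by simp
    also have "prob {\<omega> \<in> space M. ?h < B s \<omega> - B 0 \<omega>} = normal_tail (?h / sqrt s)"
      using prob_increment_greater[of 0 s ?h] sT by simp
    finally show ?thesis .
  qed
  moreover have "prob (?E0 \<inter> ?E1) \<le> prob {\<omega> \<in> space M. 0 < B s \<omega> - B 0 \<omega> \<and> B T \<omega> < B 0 \<omega>}"
    by (rule finite_measure_mono) (auto, measurable)
  ultimately show ?thesis by simp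
qed

subsection \<open>Bounds for the exit probability\<close>

text \<open>The frontier is closed, so it has a point closest to 0, which is outside the open set
  \<open>V\<close>. The open ball up to that point is connected, meets \<open>V\<close> at 0 and
  misses the frontier, so it lies in \<open>V\<close>.\<close>

lemma boundary_dist_attained:
  assumes V: "open V" "0 \<in> V" "V \<noteq> UNIV"
  obtains p where "p \<notin> V" "cmod p = boundary_dist V" "0 < boundary_dist V" "ball 0 (boundary_dist V) \<subseteq> V"
proof -
  have ne: "frontier V \<noteq> {}" using V frontier_not_empty by blast
  obtain p where p: "p \<in> frontier V" "\<And>z. z \<in> frontier V \<Longrightarrow> dist 0 p \<le> dist 0 z"
    using distance_attains_inf[OF frontier_closed ne] by blast
  have pV: "p \<notin> V" using p(1) V(1) by (auto simp: frontier_def interior_open)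
  have bd: "boundary_dist V = cmod p"
    unfolding boundary_dist_def using p by (intro cInf_eq_minimum) auto
  have "ball 0 (cmod p) \<subseteq> V"
  proof (rule ccontr)
    assume "\<not> ball 0 (cmod p) \<subseteq> V"
    moreover have "0 < cmod p" using pV V(2) by auto
    then have "0 \<in> ball 0 (cmod p) \<inter> V" using V(2) by simp
    then have "ball 0 (cmod p) \<inter> V \<noteq> {}" by blast
    ultimately have "ball 0 (cmod p) \<inter> frontier V \<noteq> {}"
      using connected_Int_frontier[OF convex_connected[OF convex_ball], of 0 "cmod p" V] by blast
    then obtain z where "z \<in> frontier V" "cmod z < cmod p" by auto
    then show False using p(2)[of z] by simp
  qed
  then show ?thesis using that pV V(2) bd by auto
qed

context planar_brownian_motion
begin

text \<open>When the imaginary part goes from positive at \<open>s\<close> to negative at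
  \<open>T\<close>, it vanishes somewhere in between, and there the real part is still at least
  \<open>d\<close> if it exceeded \<open>d + \<delta>\<close> at \<open>s\<close> and never fell by
  more than \<delta>. The two conditions concern different coordinates, so their probabilities
  multiply.\<close>

lemma ray_event:
  assumes sT: "0 < s" "s < T" and \<delta>: "0 < \<delta>"
  obtains R where "R \<in> events"
    "AE \<omega> in M. \<omega> \<in> R \<longrightarrow> (\<exists>u\<in>{0..T}. Im (Z u \<omega>) = 0 \<and> d \<le> Re (Z u \<omega>))"
    "(normal_tail 0 - normal_tail (sqrt (T - s) / sqrt s)) * normal_tail 1 *
       (normal_tail ((d + \<delta>) / sqrt s) - 2 * normal_tail (\<delta> / sqrt (T - s))) \<le> prob R"
proof -
  let ?P = "PiM {0..} (\<lambda>_. borel) :: (real \<Rightarrow> real) measure"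
  let ?X = "\<lambda>\<omega>. \<lambda>t\<in>{0..}. Re (Z t \<omega>)" and ?Y = "\<lambda>\<omega>. \<lambda>t\<in>{0..}. Im (Z t \<omega>)"
  let ?D = "dyadic_times s T"
  define C where "C = {x \<in> space ?P. d + \<delta> < x s - x 0 \<and> (\<forall>q\<in>?D. - \<delta> \<le> x q - x s)}"
  define D where "D = {y \<in> space ?P. 0 < y s - y 0 \<and> y T < y 0}"
  have Ds: "?D \<subseteq> {s..T}" using sT by (intro dyadic_times_subset) auto
  have comp: "(\<lambda>x. x u) \<in> borel_measurable ?P" if "0 \<le> u" for u
    using that by (intro measurable_component_singleton) auto
  have C: "C \<in> sets ?P" unfolding C_def
    using sT Ds by (intro sets.sets_Collect_conj sets.sets_Collect_countable_All' borel_measurable_less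
        borel_measurable_le borel_measurable_diff comp countable_dyadic_times) auto
  have D: "D \<in> sets ?P" unfolding D_def
    using sT by (intro sets.sets_Collect_conj borel_measurable_less borel_measurable_diff comp) auto
  have Xm: "?X \<in> measurable M ?P" using Re.random_variable_B by (intro measurable_restrict) auto
  have Ym: "?Y \<in> measurable M ?P" using Im.random_variable_B by (intro measurable_restrict) auto
  let ?EC = "{\<omega> \<in> space M. ?X \<omega> \<in> C}" and ?ED = "{\<omega> \<in> space M. ?Y \<omega> \<in> D}"
  define R where "R = ?EC \<inter> ?ED"
  have EC: "?EC \<in> events" using measurable_sets[OF Xm C] by (simp add: vimage_def Int_def conj_commute)
  have ED: "?ED \<in> events" using measurable_sets[OF Ym D] by (simp add: vimage_def Int_def conj_commute)
  have EC': "?EC = {\<omega> \<in> space M. d + \<delta> < Re (Z s \<omega>) - Re (Z 0 \<omega>) \<and> (\<forall>q\<in>?D. - \<delta> \<le> Re (Z q \<omega>) - Re (Z s \<omega>))}"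
    using sT Ds measurable_space[OF Xm] by (auto simp: C_def subset_eq)
  have ED': "?ED = {\<omega> \<in> space M. 0 < Im (Z s \<omega>) - Im (Z 0 \<omega>) \<and> Im (Z T \<omega>) < Im (Z 0 \<omega>)}"
    using sT measurable_space[OF Ym] by (auto simp: D_def)
  \<comment> \<open>A crude subtraction is enough: from the event of exceeding
    \<open>d + \<delta>\<close> at \<open>s\<close>, remove that of a fall by more than \<delta>,
    which is Levy's inequality for the negated real part. The parameters are chosen later so that
    the removed term has lower order.\<close>
  have pC: "normal_tail ((d + \<delta>) / sqrt s) - 2 * normal_tail (\<delta> / sqrt (T - s)) \<le> prob ?EC"
  proof -
    interpret m: standard_brownian_motion M "\<lambda>t \<omega>. - Re (Z t \<omega>)" by (rule Re.uminus)
    let ?A = "{\<omega> \<in> space M. d + \<delta> < Re (Z s \<omega>) - Re (Z 0 \<omega>)}"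
    let ?B = "{\<omega> \<in> space M. \<exists>q\<in>?D. \<delta> < - Re (Z q \<omega>) - - Re (Z s \<omega>)}"
    have [measurable]: "random_variable borel (Z s)" "random_variable borel (Z 0)" using sT by auto
    have Z: "random_variable borel (Z q)" if "q \<in> ?D" for q using that sT Ds by auto
    have A: "?A \<in> events" by measurable
    have B: "?B \<in> events"
      using Z by (intro sets.sets_Collect_countable_Ex' borel_measurable_less borel_measurable_diff
          borel_measurable_uminus borel_measurable_Re countable_dyadic_times) auto
    have "normal_tail ((d + \<delta>) / sqrt s) = prob ?A"
      using Re.prob_increment_greater[of 0 s "d + \<delta>"] sT by simp
    also have "\<dots> \<le> prob (?EC \<union> ?B)"
    proof (rule finite_measure_mono)
      show "?A \<subseteq> ?EC \<union> ?B"
      proof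
        fix \<omega> assume A: "\<omega> \<in> ?A"
        show "\<omega> \<in> ?EC \<union> ?B"
        proof (cases "\<omega> \<in> ?B")
          case False
          then have "- \<delta> \<le> Re (Z q \<omega>) - Re (Z s \<omega>)" if "q \<in> ?D" for q using A that by force
          then show ?thesis unfolding EC' using A by blast
        qed blast
      qed
    qed (use EC B in blast)
    also have "\<dots> \<le> prob ?EC + prob ?B" using EC B by (rule measure_Un_le)
    also have "prob ?B \<le> 2 * normal_tail (\<delta> / sqrt (T - s))"
      using m.maximal_inequality[of s T \<delta>] sT by simp
    finally show ?thesis by linarith
  qed
  have pD: "(normal_tail 0 - normal_tail (sqrt (T - s) / sqrt s)) * normal_tail 1 \<le> prob ?ED"
    unfolding ED' using sT by (intro Im.prob_sign_change_ge)
  have R: "prob R = prob ?EC * prob ?ED"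
    using prob_Re_Im_independent[OF C D] unfolding R_def by (simp add: Int_def conj_ac) 
  have c0: "0 \<le> (normal_tail 0 - normal_tail (sqrt (T - s) / sqrt s)) * normal_tail 1"
    using sT normal_tail_pos[of 1] by (intro mult_nonneg_nonneg) (auto intro: normal_tail_antimono less_imp_le)
  show ?thesis
  proof
    show "R \<in> events" unfolding R_def using EC ED by auto
    have "(normal_tail 0 - normal_tail (sqrt (T - s) / sqrt s)) * normal_tail 1 *
       (normal_tail ((d + \<delta>) / sqrt s) - 2 * normal_tail (\<delta> / sqrt (T - s))) \<le>
      (normal_tail 0 - normal_tail (sqrt (T - s) / sqrt s)) * normal_tail 1 * prob ?EC"
      using pC c0 by (rule mult_left_mono)
    also have "\<dots> \<le> prob ?ED * prob ?EC" using pD by (rule mult_right_mono) simp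
    finally show "(normal_tail 0 - normal_tail (sqrt (T - s) / sqrt s)) * normal_tail 1 *
       (normal_tail ((d + \<delta>) / sqrt s) - 2 * normal_tail (\<delta> / sqrt (T - s))) \<le> prob R"
      unfolding R by (simp add: mult.commute)
    show "AE \<omega> in M. \<omega> \<in> R \<longrightarrow> (\<exists>u\<in>{0..T}. Im (Z u \<omega>) = 0 \<and> d \<le> Re (Z u \<omega>))"
      using starts_at_0 continuous_paths
    proof eventually_elim
      case (elim \<omega>)
      show ?case
      proof
        assume "\<omega> \<in> R"
        then have r: "d + \<delta> < Re (Z s \<omega>)" "\<And>q. q \<in> ?D \<Longrightarrow> - \<delta> \<le> Re (Z q \<omega>) - Re (Z s \<omega>)"
           "0 < Im (Z s \<omega>)" "Im (Z T \<omega>) < 0"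
          unfolding R_def EC' ED' using elim(1) by auto
        have c: "continuous_on {s..T} (\<lambda>t. Z t \<omega>)"
          using elim(2) by (rule continuous_on_subset) (use sT in auto)
        have "\<exists>u\<ge>s. u \<le> T \<and> Im (Z u \<omega>) = 0"
          using r sT c by (intro IVT2') (auto intro!: continuous_intros)
        then obtain u where u: "s \<le> u" "u \<le> T" "Im (Z u \<omega>) = 0" by auto
        have "- Re (Z u \<omega>) \<le> - (Re (Z s \<omega>) - \<delta>)"
        proof (rule dyadic_times_le_extend[of s T "\<lambda>u. - Re (Z u \<omega>)"])
          show "- Re (Z q \<omega>) \<le> - (Re (Z s \<omega>) - \<delta>)" if "q \<in> ?D" for q using r(2)[OF that] by simp
        qed (use u sT c in \<open>auto intro!: continuous_intros\<close>)
        then show "\<exists>u\<in>{0..T}. Im (Z u \<omega>) = 0 \<and> d \<le> Re (Z u \<omega>)"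
          using u r(1) sT by (intro bexI[of _ u]) auto
      qed
    qed
  qed
qed

text \<open>Since \<open>a < b\<close>, the subtracted tail at \<open>b\<close> is negligible as
  \<open>t\<close> tends to 0. The level \<open>b\<close> is free above the boundary distance, so it
  can be matched with the level of an upper bound for another domain.\<close>

lemma exit_prob_lower_bound:
  assumes V: "open V" "simply_connected V" "0 \<in> V" "V \<noteq> UNIV" and b: "boundary_dist V < b"
  obtains a c where "0 < a" "a < b" "0 < c"
    "\<And>t. 0 < t \<Longrightarrow> c * (normal_tail (a / sqrt t) - 2 * normal_tail (b / sqrt t)) \<le> exit_prob M Z V t"
proof -
  obtain p where p: "p \<notin> V" "cmod p = boundary_dist V" "0 < boundary_dist V"
    using boundary_dist_attained[OF V(1,3,4)] by blast
  define d where "d = boundary_dist V"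
  define e where "e = p / of_real d"
  have d: "0 < d" "d < b" and e: "cmod e = 1" "e * of_real d \<notin> V"
    using p b by (auto simp: d_def e_def norm_divide)
  define \<delta> where "\<delta> = (b - d) / 2"
  have \<delta>: "0 < \<delta>" "d + \<delta> < b" using d by (auto simp: \<delta>_def field_simps)
  \<comment> \<open>Two demands push \<kappa> towards 1:
    \<open>(d + \<delta>) / sqrt \<kappa> < b\<close>, so that \<open>a < b\<close>, and
    \<open>sqrt ((1 - \<kappa>) / 2) \<le> \<delta> / b\<close>, so that a fall by \<delta> within
    time \<open>(1 - \<kappa>) * t / 2\<close> is no likelier than the tail at
    \<open>b / sqrt t\<close>, up to Levy's factor 2.\<close>
  have "((d + \<delta>) / b)\<^sup>2 < 1" using d \<delta> by (simp add: power_less_one_iff)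
  moreover have "1 - 2 * (\<delta> / b)\<^sup>2 < 1" using d \<delta> by simp
  ultimately have "max (((d + \<delta>) / b)\<^sup>2) (1 - 2 * (\<delta> / b)\<^sup>2) < 1" by simp
  then obtain \<kappa> where "max (((d + \<delta>) / b)\<^sup>2) (1 - 2 * (\<delta> / b)\<^sup>2) < \<kappa>" and \<kappa>1: "\<kappa> < 1"
    using dense by blast
  then have \<kappa>: "((d + \<delta>) / b)\<^sup>2 < \<kappa>" "(1 - \<kappa>) / 2 < (\<delta> / b)\<^sup>2" by (auto simp: field_simps)
  have \<kappa>0: "0 < \<kappa>" using \<kappa>(1) by (meson le_less_trans zero_le_power2)
  define a where "a = (d + \<delta>) / sqrt \<kappa>"
  \<comment> \<open>The bound for the sign change with \<open>s\<close> and \<open>T\<close>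
    proportional to \<open>t\<close>, halved because of the mirror path.\<close>
  define c where "c = (normal_tail 0 - normal_tail (sqrt ((1 - \<kappa>) / 2) / sqrt \<kappa>)) * normal_tail 1 / 2"
  show ?thesis
  proof
    show "0 < a" using d \<delta> \<kappa>0 by (simp add: a_def)
    have "(d + \<delta>) / b < sqrt \<kappa>" using \<kappa>(1) real_less_rsqrt by blast
    then show "a < b" using d \<kappa>0 by (simp add: a_def field_simps)
    show "0 < c" unfolding c_def using \<kappa>0 \<kappa>1 normal_tail_pos[of 1]
      by (intro divide_pos_pos mult_pos_pos) (auto intro!: normal_tail_strict_antimono)
    fix t :: real assume t: "0 < t"
    \<comment> \<open>\<open>?T\<close> is the midpoint of \<open>?s\<close> and \<open>t\<close>.
      It stays strictly below \<open>t\<close> because the exit has to occur before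
      \<open>t\<close>.\<close>
    let ?s = "\<kappa> * t" and ?T = "(1 + \<kappa>) / 2 * t"
    have sT: "0 < ?s" "?s < ?T" "?T < t" using \<kappa>0 \<kappa>1 t by (auto simp: field_simps)
    have TS: "sqrt (?T - ?s) = sqrt ((1 - \<kappa>) / 2) * sqrt t" 
      by (simp add: real_sqrt_mult[symmetric] field_simps)
    obtain R where R: "R \<in> events" "AE \<omega> in M. \<omega> \<in> R \<longrightarrow> (\<exists>u\<in>{0..?T}. Im (Z u \<omega>) = 0 \<and> d \<le> Re (Z u \<omega>))"
      "(normal_tail 0 - normal_tail (sqrt (?T - ?s) / sqrt ?s)) * normal_tail 1 *
       (normal_tail ((d + \<delta>) / sqrt ?s) - 2 * normal_tail (\<delta> / sqrt (?T - ?s))) \<le> prob R"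
      using ray_event[OF sT(1,2) \<delta>(1)] by blast
    have e1: "sqrt (?T - ?s) / sqrt ?s = sqrt ((1 - \<kappa>) / 2) / sqrt \<kappa>"
      unfolding TS using t by (simp add: real_sqrt_mult)
    have e2: "(d + \<delta>) / sqrt ?s = a / sqrt t" by (simp add: a_def real_sqrt_mult)
    have "sqrt ((1 - \<kappa>) / 2) \<le> \<delta> / b" using \<kappa>(2) d \<delta> by (intro real_le_lsqrt) auto
    then have "b \<le> \<delta> / sqrt ((1 - \<kappa>) / 2)" using d \<kappa>1 by (simp add: field_simps)
    then have "b / sqrt t \<le> \<delta> / sqrt (?T - ?s)"
      unfolding TS divide_divide_eq_left[symmetric] using t by (intro divide_right_mono) auto
    then have e3: "normal_tail (\<delta> / sqrt (?T - ?s)) \<le> normal_tail (b / sqrt t)" by (rule normal_tail_antimono)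
    have "2 * c * (normal_tail (a / sqrt t) - 2 * normal_tail (b / sqrt t)) \<le>
        2 * c * (normal_tail ((d + \<delta>) / sqrt ?s) - 2 * normal_tail (\<delta> / sqrt (?T - ?s)))"
      using e2 e3 \<open>0 < c\<close> by (intro mult_left_mono) auto
    also have "\<dots> \<le> prob R" using R(3) unfolding e1 c_def by simp
    also have "\<dots> \<le> 2 * exit_prob M Z V t"
      using sT by (intro prob_ray_le_exit_prob[OF V(1-3) d(1) e _ sT(3) R(1,2)]) auto
    finally show "c * (normal_tail (a / sqrt t) - 2 * normal_tail (b / sqrt t)) \<le> exit_prob M Z V t" by simp
  qed
qed

text \<open>The corners of the square with half side \<open>a\<close> are at distance
  \<open>sqrt 2 * a\<close> from 0, so the square lies inside the disc contained in
  \<open>V\<close>. The constant is 4 sides times the factor 2 of the maximal inequality.\<close>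

lemma exit_prob_upper_bound:
  assumes V: "open V" "V \<noteq> UNIV" "0 \<in> V" and a: "0 < a" "sqrt 2 * a < boundary_dist V" and t: "0 < t"
  shows "exit_prob M Z V t \<le> 8 * normal_tail (a / sqrt t)"
proof -
  interpret mRe: standard_brownian_motion M "\<lambda>t \<omega>. - Re (Z t \<omega>)" by (rule Re.uminus)
  interpret mIm: standard_brownian_motion M "\<lambda>t \<omega>. - Im (Z t \<omega>)" by (rule Im.uminus)
  have ball: "ball 0 (boundary_dist V) \<subseteq> V" using boundary_dist_attained[OF V(1,3,2)] by blast
  let ?D = "dyadic_times 0 t"
  have D: "?D \<subseteq> {0..t}" using t by (intro dyadic_times_subset) auto
  define E where "E B = {\<omega> \<in> space M. \<exists>q\<in>?D. a < B q \<omega> - B 0 \<omega>}" for B :: "real \<Rightarrow> 'a \<Rightarrow> real"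
  have Em: "E B \<in> events" if "standard_brownian_motion M B" for B
  proof -
    interpret B: standard_brownian_motion M B by fact
    show ?thesis unfolding E_def using D B.random_variable_B
      by (intro sets.sets_Collect_countable_Ex' borel_measurable_less borel_measurable_diff countable_dyadic_times) auto
  qed
  have pE: "prob (E B) \<le> 2 * normal_tail (a / sqrt t)" if "standard_brownian_motion M B" for B
  proof -
    interpret B: standard_brownian_motion M B by fact
    show ?thesis using B.maximal_inequality[of 0 t a] t by (simp add: E_def)
  qed
  note bm = Re.standard_brownian_motion_axioms Im.standard_brownian_motion_axioms
    mRe.standard_brownian_motion_axioms mIm.standard_brownian_motion_axioms
  let ?E1 = "E (\<lambda>t \<omega>. Re (Z t \<omega>))" and ?E2 = "E (\<lambda>t \<omega>. - Re (Z t \<omega>))"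
    and ?E3 = "E (\<lambda>t \<omega>. Im (Z t \<omega>))" and ?E4 = "E (\<lambda>t \<omega>. - Im (Z t \<omega>))"
  obtain H where H: "H \<in> events" "exit_prob M Z V t = prob H"
    "AE \<omega> in M. \<omega> \<in> H \<longleftrightarrow> (\<exists>u\<in>{0..<t}. Z u \<omega> \<notin> V)"
    using exit_prob_event[OF V t] by blast
  have "prob H \<le> prob ((?E1 \<union> ?E2) \<union> (?E3 \<union> ?E4))"
  proof (rule finite_measure_mono_AE)
    show "AE \<omega> in M. \<omega> \<in> H \<longrightarrow> \<omega> \<in> (?E1 \<union> ?E2) \<union> (?E3 \<union> ?E4)"
      using H(3) starts_at_0 continuous_paths AE_space
    proof eventually_elim
      case (elim \<omega>)
      have bound: "\<bar>f u\<bar> \<le> a" if "continuous_on {0..t} f" "u \<in> {0..t}"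
        "\<And>q. q \<in> ?D \<Longrightarrow> f q \<le> a" "\<And>q. q \<in> ?D \<Longrightarrow> - f q \<le> a" for f :: "real \<Rightarrow> real" and u
        using dyadic_times_le_extend[OF less_imp_le[OF t] that(1) that(3) that(2)]
          dyadic_times_le_extend[OF less_imp_le[OF t] continuous_on_minus[OF that(1)] that(4) that(2)]
        by (simp add: abs_le_iff)
      have c: "continuous_on {0..t} (\<lambda>u. Z u \<omega>)" using elim(3) by (rule continuous_on_subset) auto
      show ?case
      proof (rule impI, rule ccontr)
        assume "\<omega> \<in> H"
        then have "\<exists>u\<in>{0..<t}. Z u \<omega> \<notin> V" using elim(1) by blast
        then obtain u where u: "u \<in> {0..t}" "Z u \<omega> \<notin> V" by force
        assume "\<omega> \<notin> (?E1 \<union> ?E2) \<union> (?E3 \<union> ?E4)"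
        then have le: "Re (Z q \<omega>) \<le> a" "- Re (Z q \<omega>) \<le> a" "Im (Z q \<omega>) \<le> a" "- Im (Z q \<omega>) \<le> a" if "q \<in> ?D" for q
          using that elim(2,4) by (simp_all add: E_def not_less)
        have "\<bar>Re (Z u \<omega>)\<bar> \<le> a" by (rule bound[OF continuous_on_Re[OF c] u(1) le(1,2)])
        moreover have "\<bar>Im (Z u \<omega>)\<bar> \<le> a" by (rule bound[OF continuous_on_Im[OF c] u(1) le(3,4)])
        ultimately have "(Re (Z u \<omega>))\<^sup>2 + (Im (Z u \<omega>))\<^sup>2 \<le> a\<^sup>2 + a\<^sup>2"
          using a(1) by (intro add_mono) (simp_all add: abs_le_square_iff[symmetric])
        then have "cmod (Z u \<omega>) \<le> sqrt (2 * a\<^sup>2)"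
          unfolding cmod_def by (intro real_sqrt_le_mono) simp
        also have "\<dots> = sqrt 2 * a" using a(1) by (simp add: real_sqrt_mult)
        finally have "Z u \<omega> \<in> ball 0 (boundary_dist V)" using a(2) by simp
        then show False using ball u(2) by blast
      qed
    qed
  qed (use Em bm in auto)
  also have "\<dots> \<le> (prob ?E1 + prob ?E2) + (prob ?E3 + prob ?E4)"
    using Em bm by (intro order_trans[OF measure_Un_le add_mono[OF measure_Un_le measure_Un_le]] sets.Un) auto
  also have "\<dots> \<le> 8 * normal_tail (a / sqrt t)"
    using pE[OF bm(1)] pE[OF bm(2)] pE[OF bm(3)] pE[OF bm(4)] by linarith
  finally show ?thesis unfolding H(2) .
qed

end

theorem theorem1:
  fixes M :: "'a measure" and Z :: "real \<Rightarrow> 'a \<Rightarrow> complex" and U W :: "complex set"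
  assumes "planar_brownian_motion M Z"
    and "simply_connected_domain U" and "U \<noteq> UNIV" and "0 \<in> U"
    and "simply_connected_domain W" and "W \<noteq> UNIV" and "0 \<in> W"
    and "boundary_dist U < 1 / sqrt 2 * boundary_dist W"
  shows "(\<forall>\<^sub>F t in at_right 0. exit_prob M Z U t > exit_prob M Z W t) \<and>
         filterlim (\<lambda>t. exit_prob M Z U t / exit_prob M Z W t) at_top (at_right 0)"
proof -
  interpret planar_brownian_motion M Z by fact
  have U: "open U" "simply_connected U" "0 \<in> U" "U \<noteq> UNIV"
    and W: "open W" "simply_connected W" "0 \<in> W" "W \<noteq> UNIV"
    using assms by (auto simp: simply_connected_domain_def)
  have dU: "0 < boundary_dist U" using boundary_dist_attained[OF U(1,3,4)] by blast
  \<comment> \<open>The same level \<open>b\<close> serves in the lower bound for \<open>U\<close>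
    and in the upper bound for \<open>W\<close>; the strict hypothesis on the distances leaves room
    for it.\<close>
  obtain b where b: "boundary_dist U < b" "b < 1 / sqrt 2 * boundary_dist W"
    using dense[OF assms(8)] by blast
  have b0: "0 < b" and bW: "sqrt 2 * b < boundary_dist W" using dU b by (auto simp: field_simps)
  obtain a c where a: "0 < a" "a < b" "0 < c" and
    low: "\<And>t. 0 < t \<Longrightarrow> c * (normal_tail (a / sqrt t) - 2 * normal_tail (b / sqrt t)) \<le> exit_prob M Z U t"
    using exit_prob_lower_bound[OF U b(1)] by blast
  \<comment> \<open>The lower bound for \<open>W\<close> only serves to show that the denominator is
    eventually positive, as division by zero would give 0. Any level above the boundary distance
    will do.\<close>
  obtain a' b' c' where a': "0 < a'" "a' < b'" "0 < c'" and
    low': "\<And>t. 0 < t \<Longrightarrow> c' * (normal_tail (a' / sqrt t) - 2 * normal_tail (b' / sqrt t)) \<le> exit_prob M Z W t"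
    using exit_prob_lower_bound[OF W, of "boundary_dist W + 1"] by (metis less_add_one)
  have "\<forall>\<^sub>F t in at_right 0. 2 < normal_tail (a' / sqrt t) / normal_tail (b' / sqrt t)"
    using normal_tail_ratio_at_top[OF a'(1,2)] by (auto simp: filterlim_at_top_dense)
  then have Wpos: "\<forall>\<^sub>F t in at_right 0. 0 < exit_prob M Z W t"
    using eventually_at_right_less[of 0]
  proof eventually_elim
    case (elim t)
    then have "0 < normal_tail (a' / sqrt t) - 2 * normal_tail (b' / sqrt t)"
      using normal_tail_pos[of "b' / sqrt t"] by (simp add: field_simps)
    then show ?case using low'[OF elim(2)] a'(3) by (meson less_le_trans mult_pos_pos)
  qed
  have lim: "filterlim (\<lambda>t. exit_prob M Z U t / exit_prob M Z W t) at_top (at_right 0)"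
  proof (rule filterlim_at_top_mono)
    have "filterlim (\<lambda>t. - 2 + normal_tail (a / sqrt t) / normal_tail (b / sqrt t)) at_top (at_right 0)"
      by (intro filterlim_tendsto_add_at_top[OF tendsto_const] normal_tail_ratio_at_top a)
    then show "filterlim (\<lambda>t. (c / 8) * (- 2 + normal_tail (a / sqrt t) / normal_tail (b / sqrt t))) at_top (at_right 0)"
      using a(3) by (intro filterlim_tendsto_pos_mult_at_top[OF tendsto_const]) auto
    have "\<forall>\<^sub>F t in at_right 0. 2 < normal_tail (a / sqrt t) / normal_tail (b / sqrt t)"
      using normal_tail_ratio_at_top[OF a(1,2)] by (auto simp: filterlim_at_top_dense)
    then show "\<forall>\<^sub>F t in at_right 0. (c / 8) * (- 2 + normal_tail (a / sqrt t) / normal_tail (b / sqrt t))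
        \<le> exit_prob M Z U t / exit_prob M Z W t"
      using Wpos eventually_at_right_less[of 0]
    proof eventually_elim
      case (elim t)
      let ?A = "normal_tail (a / sqrt t)" and ?B = "normal_tail (b / sqrt t)"
      have B: "0 < ?B" by (rule normal_tail_pos)
      have pos: "0 < ?A - 2 * ?B" using elim(1) B by (simp add: field_simps)
      \<comment> \<open>The comparison function is the lower bound for \<open>U\<close> divided by
        the upper bound \<open>8 * ?B\<close> for \<open>W\<close>. Enlarging the denominator needs
        the numerator nonnegative, which holds once \<open>?A / ?B\<close> exceeds 2.\<close>
      have "(c / 8) * (- 2 + ?A / ?B) = c * (?A - 2 * ?B) / (8 * ?B)" using B by (simp add: field_simps)
      also have "\<dots> \<le> c * (?A - 2 * ?B) / exit_prob M Z W t"
        using exit_prob_upper_bound[OF W(1,4,3) b0 bW elim(3)] elim(2) B pos a(3)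
        by (intro divide_left_mono mult_pos_pos mult_nonneg_nonneg) auto
      also have "\<dots> \<le> exit_prob M Z U t / exit_prob M Z W t"
        using low[OF elim(3)] elim(2) by (intro divide_right_mono) auto
      finally show ?case .
    qed
  qed
  have "\<forall>\<^sub>F t in at_right 0. 1 < exit_prob M Z U t / exit_prob M Z W t"
    using lim by (auto simp: filterlim_at_top_dense)
  then have "\<forall>\<^sub>F t in at_right 0. exit_prob M Z U t > exit_prob M Z W t"
    using Wpos by eventually_elim (simp add: field_simps)
  with lim show ?thesis by blast
qed

end
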